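(* Let $X,Y$ be random variables on $\mathbb R^d$. Then $$\lim_{\kappa\to\infty}\ \lim_{\delta\to0}\ D_{\mathrm{KL}}\big(\{X\}^\kappa_\delta\,\big|\,\{Y\}^\kappa_\delta\big)=D_{\mathrm{KL}}(X|Y).$$
   Context: $D_{\mathrm{KL}}(X|Y)\in[0,\infty]$ is the relative entropy $\int\ln(dp/dq)\,dp$ of the law $p$ of $X$ with respect to the law $q$ of $Y$ ($+\infty$ if $p\not\ll q$). Quantization with mesh size $\delta>0$ and window size $\kappa>0$: suppose first that $\kappa/\delta$ is an integer. Then $\{\cdot\}_\delta^\kappa:\mathbb R^d\to(\delta\mathbb Z\cap[-\kappa,\kappa))^d\cup\{\omega\}$, where $\omega\in\mathbb R^d\setminus(\delta\mathbb Z)^d$ is any default value, is defined as follows. For $d=1$: $\{x\}_\delta^\kappa=\omega$ if $|x|\ge\kappa$; $\{x\}_\delta^\kappa=\lfloor x/\delta\rfloor\delta$ if $0\le x<\kappa$; $\{x\}_\delta^\kappa=-\{-x\}_\delta^\kappa$ if $-\kappa<x<0$. On $\mathbb R^d$ it is applied coordinatewise, $\{(x_1,\dots,x_d)\}^\kappa_\delta=(\{x_1\}^\kappa_\delta,\dots,\{x_d\}^\kappa_\delta)$, with value $\omega$ if $\max_i|x_i|\ge\kappa$. Finally, if $\kappa/\delta$ is not an integer, $\{x\}^\kappa_\delta:=\{x\}^{\kappa'}_\delta$ with $\kappa'=\delta\lceil\kappa/\delta\rceil$.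
   Formalization: The inner limit δ→0 can fail to exist at arbitrarily large κ (atoms at distance κ), so the formal claim says: it exists for all but countably many κ>0, and the lower and upper limits as δ→0 both tend to D_KL(X|Y) as κ→∞. *)

theory Defs
  imports "HOL-Probability.Probability"
begin

(* Relative entropy of p with respect to q, with values in the extended reals.
   KL_divergence takes the reference measure first, and its base exp 1 gives the natural logarithm.
   For probability measures with p absolutely continuous w.r.t. q the negative part of
   ln (dp/dq) is always p-integrable, so non-integrability means that the integral is +infinity,
   whereas the Bochner integral inside KL_divergence would return 0. *)
definition relative_entropy :: "'a measure \<Rightarrow> 'a measure \<Rightarrow> ereal" where
  "relative_entropy p q =
     (if absolutely_continuous q p \<and> integrable p (entropy_density (exp 1) q p)
      then ereal (KL_divergence (exp 1) q p) else \<infinity>)"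

(* D_KL(X|Y); X and Y may live on different probability spaces. *)
definition D_KL ::
  "'a measure \<Rightarrow> ('a \<Rightarrow> 'v::topological_space) \<Rightarrow> 'b measure \<Rightarrow> ('b \<Rightarrow> 'v) \<Rightarrow> ereal" where
  "D_KL M X N Y = relative_entropy (distr M borel X) (distr N borel Y)"

definition scaled_lattice :: "real \<Rightarrow> (real ^ 'n) set" where
  "scaled_lattice \<delta> = {v. \<forall>i. \<exists>k::int. v $ i = \<delta> * of_int k}"

(* Rounding towards 0 on the mesh: the value of the one-dimensional quantization inside the window. *)
definition mesh_round :: "real \<Rightarrow> real \<Rightarrow> real" where
  "mesh_round \<delta> x =
     (if 0 \<le> x then of_int \<lfloor>x / \<delta>\<rfloor> * \<delta> else - (of_int \<lfloor>- x / \<delta>\<rfloor> * \<delta>))"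

definition window :: "real \<Rightarrow> real \<Rightarrow> real" where
  "window \<kappa> \<delta> = (if \<kappa> / \<delta> \<in> \<int> then \<kappa> else \<delta> * of_int \<lceil>\<kappa> / \<delta>\<rceil>)"

(* w is the default value omega; it has to be chosen per mesh size, since
   (in dimension one, say) every nonzero real lies in some scaled lattice. *)
definition quantize :: "real ^ 'n \<Rightarrow> real \<Rightarrow> real \<Rightarrow> real ^ 'n \<Rightarrow> real ^ 'n" where
  "quantize w \<kappa> \<delta> x =
     (if \<exists>i. window \<kappa> \<delta> \<le> \<bar>x $ i\<bar> then w else (\<chi> i. mesh_round \<delta> (x $ i)))"

(* On the iterated limit: for an individual window size \<kappa> the limit as the mesh \<delta> tends to 0 need
   not exist. If the laws have atoms at distance \<kappa> from the origin, then these are sent to the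
   default value when \<kappa>/\<delta> is an integer and kept otherwise, and both happen for arbitrarily small
   \<delta>; with atoms at all integers this occurs for arbitrarily large \<kappa>. The iterated limit is
   therefore expressed by three facts: the inner limit exists for all but countably many \<kappa>, and
   both the lower and the upper inner limit, which are defined for every \<kappa> and coincide with the
   inner limit wherever it exists, converge to the relative entropy as \<kappa> tends to infinity. *)

end

theory Submission
  imports Defs
begin

text \<open>
By the Donsker--Varadhan formula, the relative entropy of \<open>P\<close> with respect to \<open>Q\<close> is the supremum
of \<open>J g = \<integral> g dP - ln \<integral> e\<^sup>g dQ\<close> over bounded Borel functions \<open>g\<close>. Let \<open>E \<kappa>\<close> be the supremum over
those \<open>g\<close> that are constant outside the open window of size \<open>\<kappa>\<close>. As \<open>\<kappa> \<rightarrow> \<infinity>\<close>, it increases to the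
full relative entropy. An observable of the quantization with parameters \<open>\<kappa>\<close> and \<open>\<delta>\<close> is constant
outside the window of size \<open>\<kappa> + \<delta>\<close>, so the quantized entropy is at most \<open>E (\<kappa> + \<delta>)\<close>. Conversely,
approximating \<open>g\<close> in \<open>L\<^sup>1(P)\<close> and \<open>L\<^sup>1(Q)\<close> by continuous functions and composing these with the
quantization shows that the lower inner limit is at least \<open>E \<kappa>\<close>. Hence the inner limit exists
wherever the monotone function \<open>E\<close> is continuous from the right, and both the lower and the upper
inner limit lie between \<open>E \<kappa>\<close> and \<open>E (\<kappa> + 1)\<close>.
\<close>

section \<open>The Donsker--Varadhan formula\<close>

text \<open>The functional \<open>J\<close> of the outline. Bochner integrals default to 0 for
  non-integrable functions, so the value is meaningful for bounded measurable \<open>g\<close>, the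
  only case in which it is used.\<close>

definition dv_functional :: "'a measure \<Rightarrow> 'a measure \<Rightarrow> ('a \<Rightarrow> real) \<Rightarrow> real" where
  "dv_functional P Q g = (\<integral>x. g x \<partial>P) - ln (\<integral>x. exp (g x) \<partial>Q)"

lemma (in prob_space) integrable_exp_bounded:
  fixes g :: "'a \<Rightarrow> real"
  assumes [measurable]: "g \<in> borel_measurable M" and B: "\<And>x. \<bar>g x\<bar> \<le> B"
  shows "integrable M (\<lambda>x. exp (g x))"
proof (rule integrable_const_bound)
  show "AE x in M. norm (exp (g x)) \<le> exp B"
    using B by (auto simp: abs_le_iff)
qed simp

lemma (in prob_space) integral_exp_pos:
  fixes g :: "'a \<Rightarrow> real"
  assumes [measurable]: "g \<in> borel_measurable M" and B: "\<And>x. \<bar>g x\<bar> \<le> B"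
  shows "0 < (\<integral>x. exp (g x) \<partial>M)"
proof -
  have "exp (- B) = (\<integral>x. exp (- B) \<partial>M)"
    by (simp add: prob_space)
  also have "\<dots> \<le> (\<integral>x. exp (g x) \<partial>M)"
    using B integrable_exp_bounded[OF assms]
    by (intro integral_mono) (auto simp: abs_le_iff minus_le_iff)
  finally show ?thesis
    by (meson exp_gt_zero less_le_trans)
qed

text \<open>Gibbs' inequality. With \<open>f\<close> the density of \<open>P\<close> and
  \<open>Z\<close> the \<open>Q\<close>-integral of \<open>exp g\<close>, the function
  \<open>h = exp g / (Z * f)\<close> has \<open>P\<close>-integral at most 1. Integrating
  \<open>ln h \<le> h - 1\<close> against \<open>P\<close> gives the bound.\<close>

lemma dv_functional_le_relative_entropy:
  assumes "prob_space P" and "prob_space Q" and sets: "sets P = sets Q"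
    and g: "g \<in> borel_measurable Q" and B: "\<And>x. \<bar>g x\<bar> \<le> B"
  shows "ereal (dv_functional P Q g) \<le> relative_entropy P Q"
proof (cases "absolutely_continuous Q P \<and> integrable P (entropy_density (exp 1) Q P)")
  case True
  interpret P: prob_space P by fact
  interpret Q: prob_space Q by fact
  have ac: "absolutely_continuous Q P" using True ..
  note [measurable_cong] = sets
  note [measurable] = g
  define f where "f x = enn2real (RN_deriv Q P x)" for x
  have f[measurable]: "f \<in> borel_measurable Q" by (simp add: f_def[abs_def])
  have ln_f: "entropy_density (exp 1) Q P = (\<lambda>x. ln (f x))"
    by (auto simp: entropy_density_def f_def log_def fun_eq_iff)
  have int_ln: "integrable P (\<lambda>x. ln (f x))" using True by (simp add: ln_f)
  \<comment> \<open>The density is known to be finite only \<open>Q\<close>-almost everywhere;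
    absolute continuity carries this over to \<open>P\<close>, where the density is also
    positive.\<close>
  obtain D where "AE x in Q. RN_deriv Q P x = ennreal (D x)" "AE x in P. 0 < D x" "\<And>x. 0 \<le> D x"
    using Q.real_RN_deriv[OF P.finite_measure_axioms ac sets] by metis
  moreover from this have "AE x in P. RN_deriv Q P x = ennreal (D x)"
    using absolutely_continuous_AE[OF sets ac] by blast
  ultimately have f_pos: "AE x in P. 0 < f x"
    by (auto simp: f_def elim!: eventually_elim2)
  define Z where "Z = (\<integral>x. exp (g x) \<partial>Q)"
  have Z: "0 < Z" unfolding Z_def by (rule Q.integral_exp_pos[OF g B])
  have int_exp: "integrable Q (\<lambda>x. exp (g x))" by (rule Q.integrable_exp_bounded[OF g B])
  have int_g: "integrable P g"
    by (rule P.integrable_const_bound[where B=B]) (use B in auto)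
  have f_nonneg: "0 \<le> f x" for x by (simp add: f_def)
  define h where "h x = exp (g x) / (Z * f x)" for x
  have h[measurable]: "h \<in> borel_measurable Q" unfolding h_def[abs_def] by measurable
  \<comment> \<open>Division by zero makes the left side 0 where \<open>f x = 0\<close>, so equality
    may fail there; the inequality suffices.\<close>
  have fh_le: "f x * h x \<le> exp (g x) / Z" for x
    using f_nonneg[of x] Z by (auto simp: h_def)
  have int_fh: "integrable Q (\<lambda>x. f x * h x)"
    by (rule Bochner_Integration.integrable_bound[where f="\<lambda>x. exp (g x) / Z"])
       (use int_exp fh_le f_nonneg Z in \<open>auto simp: abs_mult abs_of_nonneg h_def\<close>)
  have int_h: "integrable P h"
    using Q.RN_deriv_integrable[OF P.sigma_finite_measure_axioms ac sets h] int_fh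
    by (simp add: f_def)
  have "(\<integral>x. h x \<partial>P) = (\<integral>x. f x * h x \<partial>Q)"
    using Q.RN_deriv_integral[OF P.sigma_finite_measure_axioms ac sets h] by (simp add: f_def)
  also have "\<dots> \<le> (\<integral>x. exp (g x) / Z \<partial>Q)"
    using int_fh int_exp fh_le by (intro integral_mono) auto
  also have "\<dots> = 1" using Z by (simp add: Z_def)
  finally have h_le: "(\<integral>x. h x \<partial>P) \<le> 1" .
  have "(\<integral>x. g x - ln Z - ln (f x) \<partial>P) \<le> (\<integral>x. h x - 1 \<partial>P)"
  proof (rule integral_mono_AE)
    show "AE x in P. g x - ln Z - ln (f x) \<le> h x - 1"
      using f_pos
    proof eventually_elim
      case (elim x)
      have "ln (h x) \<le> h x - 1" using elim Z by (intro ln_le_minus_one) (simp add: h_def)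
      moreover have "ln (h x) = g x - ln Z - ln (f x)"
        using elim Z by (simp add: h_def ln_div ln_mult)
      ultimately show ?case by simp
    qed
  qed (use int_g int_ln int_h in auto)
  also have "\<dots> \<le> 0" using int_h h_le by (simp add: P.prob_space)
  finally have "(\<integral>x. g x \<partial>P) - ln Z - (\<integral>x. ln (f x) \<partial>P) \<le> 0"
    using int_g int_ln by (simp add: P.prob_space)
  then show ?thesis
    using True by (simp add: relative_entropy_def KL_divergence_def ln_f dv_functional_def Z_def)
qed (auto simp: relative_entropy_def)

lemma tendsto_dv_functional:
  assumes "prob_space P" and "prob_space Q" and sets: "sets P = sets Q"
    and s: "\<And>k. s k \<in> borel_measurable Q" and g: "g \<in> borel_measurable Q"
    and B: "\<And>k x. \<bar>s k x\<bar> \<le> B" and lim: "\<And>x. (\<lambda>k. s k x) \<longlonglongrightarrow> g x"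
  shows "(\<lambda>k. dv_functional P Q (s k)) \<longlonglongrightarrow> dv_functional P Q g"
proof -
  interpret P: prob_space P by fact
  interpret Q: prob_space Q by fact
  note [measurable_cong] = sets
  note [measurable] = s g
  have gB: "\<bar>g x\<bar> \<le> B" for x
    using lim[THEN tendsto_rabs] by (rule LIMSEQ_le_const2) (use B in auto)
  have "(\<lambda>k. \<integral>x. s k x \<partial>P) \<longlonglongrightarrow> (\<integral>x. g x \<partial>P)"
    by (rule integral_dominated_convergence[where w="\<lambda>_. B"]) (use B lim in auto)
  moreover have "(\<lambda>k. \<integral>x. exp (s k x) \<partial>Q) \<longlonglongrightarrow> (\<integral>x. exp (g x) \<partial>Q)"
    by (rule integral_dominated_convergence[where w="\<lambda>_. exp B"])
       (use B lim in \<open>auto simp: abs_le_iff intro!: tendsto_exp\<close>)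
  ultimately show ?thesis
    unfolding dv_functional_def using Q.integral_exp_pos[OF g gB]
    by (intro tendsto_intros) auto
qed

text \<open>Observables of an image measure are observables of the original measure composed with
  the map. Through this, both bounds on the quantized entropy are reduced to functionals of the
  unquantized laws.\<close>

lemma dv_functional_distr:
  assumes T: "T \<in> measurable Q R" and sets: "sets P = sets Q" and h: "h \<in> borel_measurable R"
  shows "dv_functional (distr P R T) (distr Q R T) h = dv_functional P Q (h \<circ> T)"
proof -
  note [measurable_cong] = sets
  note [measurable] = T h
  show ?thesis by (simp add: dv_functional_def integral_distr)
qed

text \<open>If \<open>A\<close> witnesses the failure of absolute continuity, then
  \<open>exp (t * indicator A x)\<close> equals 1 for \<open>Q\<close>-almost all \<open>x\<close>
  and the logarithmic term vanishes. Letting \<open>t\<close> grow makes the functional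
  unbounded.\<close>

lemma dv_functional_indicator_linear:
  assumes "prob_space P" and "prob_space Q" and sets: "sets P = sets Q"
    and A: "A \<in> null_sets Q" "A \<notin> null_sets P"
  shows "\<exists>p>0. \<forall>t. dv_functional P Q (\<lambda>x. t * indicator A x) = t * p"
proof (intro exI[of _ "measure P A"] conjI allI)
  interpret P: prob_space P by fact
  interpret Q: prob_space Q by fact
  have [measurable]: "A \<in> sets P" "A \<in> sets Q" using A sets by auto
  show "0 < measure P A"
    using A(2) \<open>A \<in> sets P\<close> by (auto simp: P.emeasure_eq_measure zero_less_measure_iff)
  fix t :: real
  have "AE x in Q. exp (t * indicator A x) = 1"
    using AE_not_in[OF A(1)] by eventually_elim simp
  then have "(\<integral>x. exp (t * indicator A x) \<partial>Q) = (\<integral>x. 1 \<partial>Q)"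
    by (intro integral_cong_AE) auto
  then show "dv_functional P Q (\<lambda>x. t * indicator A x) = t * measure P A"
    using sets.sets_into_space[OF \<open>A \<in> sets P\<close>]
    by (simp add: dv_functional_def Q.prob_space Int_absorb2)
qed

text \<open>The formal optimizer is \<open>ln f\<close>, with \<open>f\<close> the density of
  \<open>P\<close>, but it need not be bounded. Its truncations at level \<open>k\<close> are
  admissible up to an error \<open>exp (- k)\<close>. They first show that \<open>ln f\<close> is
  \<open>P\<close>-integrable and then, as \<open>k\<close> grows, that its integral is at most
  \<open>r\<close>. Absolute continuity comes from the preceding lemma.\<close>

lemma relative_entropy_le_if_dv_functional_le:
  fixes r :: real
  assumes "prob_space P" and "prob_space Q" and sets: "sets P = sets Q"
    and le: "\<And>g B. g \<in> borel_measurable Q \<Longrightarrow> (\<And>x. \<bar>g x\<bar> \<le> B) \<Longrightarrow> dv_functional P Q g \<le> r"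
  shows "relative_entropy P Q \<le> ereal r"
proof -
  interpret P: prob_space P by fact
  interpret Q: prob_space Q by fact
  note [measurable_cong] = sets
  have ac: "absolutely_continuous Q P"
  proof (rule ccontr)
    assume "\<not> absolutely_continuous Q P"
    then obtain A where A: "A \<in> null_sets Q" "A \<notin> null_sets P"
      by (auto simp: absolutely_continuous_def)
    from dv_functional_indicator_linear[OF assms(1-3) A] obtain p where p: "0 < p"
      "\<And>t. dv_functional P Q (\<lambda>x. t * indicator A x) = t * p" by auto
    have "t * p \<le> r" for t
      unfolding p(2)[symmetric]
      by (rule le[where B="\<bar>t\<bar>"]) (use A in \<open>auto simp: indicator_def\<close>)
    from this[of "(r + 1) / p"] p(1) show False by simp
  qed
  define f where "f x = enn2real (RN_deriv Q P x)" for x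
  have f[measurable]: "f \<in> borel_measurable Q" by (simp add: f_def[abs_def])
  have ln_f: "entropy_density (exp 1) Q P = (\<lambda>x. ln (f x))"
    by (auto simp: entropy_density_def f_def log_def fun_eq_iff)
  obtain D where "AE x in Q. RN_deriv Q P x = ennreal (D x)" "AE x in P. 0 < D x" "\<And>x. 0 \<le> D x"
    using Q.real_RN_deriv[OF P.finite_measure_axioms ac sets] by metis
  moreover from this have "AE x in P. RN_deriv Q P x = ennreal (D x)"
    using absolutely_continuous_AE[OF sets ac] by blast
  ultimately have f_pos: "AE x in P. 0 < f x"
    by (auto simp: f_def elim!: eventually_elim2)
  have f_nonneg: "0 \<le> f x" for x by (simp add: f_def)
  note RN = Q.RN_deriv_integrable[OF P.sigma_finite_measure_axioms ac sets, folded f_def]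
    Q.RN_deriv_integral[OF P.sigma_finite_measure_axioms ac sets, folded f_def]
  have int_f: "integrable Q f" "(\<integral>x. f x \<partial>Q) = 1"
    using RN(1)[of "\<lambda>_. 1"] RN(2)[of "\<lambda>_. 1"] by (auto simp: P.prob_space)
  define clamp where "clamp k x = max (- real k) (min (real k) (ln (f x)))" for k x
  have clamp[measurable]: "clamp k \<in> borel_measurable Q" for k
    unfolding clamp_def[abs_def] by measurable
  have int_clamp: "integrable P (clamp k)" for k
    by (rule P.integrable_const_bound[where B=k]) (auto simp: clamp_def)
  have clamp_le: "(\<integral>x. clamp k x \<partial>P) \<le> r + exp (- real k)" for k
  proof -
    \<comment> \<open>the case distinction is needed because \<open>ln 0 = 0\<close>\<close>
    define g where "g x = (if f x = 0 then - real k else clamp k x)" for x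
    have g[measurable]: "g \<in> borel_measurable Q" unfolding g_def[abs_def] by measurable
    have gB: "\<bar>g x\<bar> \<le> real k" for x by (auto simp: g_def clamp_def)
    \<comment> \<open>Truncating from above only lowers \<open>ln (f x)\<close>, and truncating from
      below yields exactly \<open>- real k\<close>. The two summands cover these cases, and
      \<open>f\<close> has \<open>Q\<close>-integral 1.\<close>
    have "exp (g x) \<le> f x + exp (- real k)" for x
    proof (cases "0 < f x")
      case True
      then consider "g x \<le> ln (f x)" | "g x = - real k"
        by (fastforce simp: g_def clamp_def max_def min_def split: if_splits)
      then show ?thesis
      proof cases
        case 1
        then have "exp (g x) \<le> f x" using True by (metis exp_le_cancel_iff exp_ln)
        then show ?thesis by (simp add: add_increasing2)
      qed (use True in simp)
    qed (use f_nonneg[of x] in \<open>auto simp: g_def\<close>)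
    then have "(\<integral>x. exp (g x) \<partial>Q) \<le> (\<integral>x. f x + exp (- real k) \<partial>Q)"
      using int_f Q.integrable_exp_bounded[OF g gB] by (intro integral_mono) auto
    also have "\<dots> = 1 + exp (- real k)" using int_f by (simp add: Q.prob_space)
    finally have "ln (\<integral>x. exp (g x) \<partial>Q) \<le> ln (1 + exp (- real k))"
      using Q.integral_exp_pos[OF g gB] by simp
    also have "\<dots> \<le> exp (- real k)" by (rule ln_add_one_self_le_self) simp
    finally have "ln (\<integral>x. exp (g x) \<partial>Q) \<le> exp (- real k)" .
    moreover have "(\<integral>x. g x \<partial>P) = (\<integral>x. clamp k x \<partial>P)"
      using f_pos by (intro integral_cong_AE) (auto simp: g_def)
    moreover have "dv_functional P Q g \<le> r" by (rule le[OF g gB])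
    ultimately show ?thesis by (simp add: dv_functional_def)
  qed
  \<comment> \<open>Multiplying by the density leaves a function bounded by 1. Since
    \<open>ln (1 / f x) \<le> 1 / f x - 1\<close>, the negative part of \<open>ln f\<close> is then
    integrable as well.\<close>
  have int_inv: "integrable P (\<lambda>x. 1 / f x)"
  proof -
    have "integrable Q (\<lambda>x. f x * (1 / f x))"
      by (rule Q.integrable_const_bound[where B=1]) auto
    then show ?thesis using RN(1)[of "\<lambda>x. 1 / f x"] by simp
  qed
  define neg where "neg x = max 0 (- ln (f x))" for x
  have neg[measurable]: "neg \<in> borel_measurable Q" unfolding neg_def[abs_def] by measurable
  have int_neg: "integrable P neg"
  proof (rule Bochner_Integration.integrable_bound[OF int_inv])
    show "AE x in P. norm (neg x) \<le> norm (1 / f x)"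
      using f_pos
    proof eventually_elim
      case (elim x)
      have "ln (1 / f x) \<le> 1 / f x - 1" using elim by (intro ln_le_minus_one) simp
      then show ?case using elim by (simp add: neg_def ln_div)
    qed
  qed simp
  define pos where "pos k x = min (real k) (max 0 (ln (f x)))" for k x
  have pos[measurable]: "pos k \<in> borel_measurable Q" for k unfolding pos_def[abs_def] by measurable
  have int_pos: "integrable P (pos k)" for k
    by (rule P.integrable_const_bound[where B=k]) (auto simp: pos_def)
  have pos_clamp: "pos k x \<le> clamp k x + neg x" for k x
    by (auto simp: pos_def clamp_def neg_def)
  have pos_Suc: "pos k x \<le> pos (Suc k) x" for k x
    by (auto simp: pos_def)
  \<comment> \<open>The bound is uniform in \<open>k\<close>, so monotone convergence makes the
    positive part of \<open>ln f\<close> integrable.\<close>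
  have pos_le: "(\<integral>x. pos k x \<partial>P) \<le> r + 1 + (\<integral>x. neg x \<partial>P)" for k
  proof -
    have "(\<integral>x. pos k x \<partial>P) \<le> (\<integral>x. clamp k x + neg x \<partial>P)"
      using int_pos int_clamp int_neg pos_clamp by (intro integral_mono) auto
    also have "\<dots> \<le> r + exp (- real k) + (\<integral>x. neg x \<partial>P)"
      using int_clamp int_neg clamp_le[of k] by simp
    also have "exp (- real k) \<le> 1" by simp
    finally show ?thesis by simp
  qed
  have "incseq (\<lambda>k. \<integral>x. pos k x \<partial>P)"
    using int_pos pos_Suc by (intro incseq_SucI integral_mono) auto
  then obtain l where l: "(\<lambda>k. \<integral>x. pos k x \<partial>P) \<longlonglongrightarrow> l"
    using incseq_convergent[of "\<lambda>k. \<integral>x. pos k x \<partial>P"] pos_le by blast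
  have int_max: "integrable P (\<lambda>x. max 0 (ln (f x)))"
  proof (rule integrable_monotone_convergence[OF int_pos _ _ l])
    show "AE x in P. mono (\<lambda>n. pos n x)" by (auto simp: pos_def mono_def)
    show "AE x in P. (\<lambda>i. pos i x) \<longlonglongrightarrow> max 0 (ln (f x))"
    proof (rule always_eventually, rule allI, rule tendsto_eventually)
      fix x
      show "\<forall>\<^sub>F k in sequentially. pos k x = max 0 (ln (f x))"
        using eventually_ge_at_top[of "nat \<lceil>max 0 (ln (f x))\<rceil>"]
        by eventually_elim (auto simp: pos_def nat_ceiling_le_eq)
    qed
  qed simp
  have "integrable P (\<lambda>x. max 0 (ln (f x)) - neg x)"
    using int_max int_neg by simp
  moreover have "(\<lambda>x. max 0 (ln (f x)) - neg x) = (\<lambda>x. ln (f x))" by (auto simp: neg_def)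
  ultimately have int_ln: "integrable P (\<lambda>x. ln (f x))" by simp
  \<comment> \<open>Integrability of \<open>ln f\<close> is now available, so its absolute value can
    serve as the dominating function.\<close>
  have "(\<lambda>k. \<integral>x. clamp k x \<partial>P) \<longlonglongrightarrow> (\<integral>x. ln (f x) \<partial>P)"
  proof (rule integral_dominated_convergence[where w="\<lambda>x. \<bar>ln (f x)\<bar>"])
    show "AE x in P. (\<lambda>k. clamp k x) \<longlonglongrightarrow> ln (f x)"
    proof (rule always_eventually, rule allI, rule tendsto_eventually)
      fix x
      show "\<forall>\<^sub>F k in sequentially. clamp k x = ln (f x)"
        using eventually_ge_at_top[of "nat \<lceil>\<bar>ln (f x)\<bar>\<rceil>"]
        by eventually_elim (auto simp: clamp_def nat_ceiling_le_eq)
    qed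
  qed (use int_ln in \<open>auto simp: clamp_def\<close>)
  moreover have "(\<lambda>k. r + exp (- real k)) \<longlonglongrightarrow> r + 0"
    by (intro tendsto_add tendsto_const filterlim_compose[OF exp_at_bot]
        filterlim_compose[OF filterlim_uminus_at_bot_at_top] filterlim_real_sequentially)
  ultimately have "(\<integral>x. ln (f x) \<partial>P) \<le> r"
    using clamp_le by (auto intro: LIMSEQ_le)
  then show ?thesis
    using ac int_ln by (simp add: relative_entropy_def KL_divergence_def ln_f)
qed

theorem donsker_varadhan:
  assumes P: "prob_space P" and Q: "prob_space Q" and sets: "sets P = sets Q"
  shows "relative_entropy P Q =
    (SUP g\<in>{g \<in> borel_measurable Q. \<exists>B. \<forall>x. \<bar>g x\<bar> \<le> B}. ereal (dv_functional P Q g))"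
    (is "_ = ?S")
proof (rule antisym)
  show "?S \<le> relative_entropy P Q"
    by (rule SUP_least) (auto intro: dv_functional_le_relative_entropy[OF assms])
  define S where "S = ?S"
  have upper: "ereal (dv_functional P Q g) \<le> S"
    if "g \<in> borel_measurable Q" "\<And>x. \<bar>g x\<bar> \<le> B" for g B
    unfolding S_def using that by (intro SUP_upper) auto
  have "relative_entropy P Q \<le> S"
  proof (cases S)
    case (real r)
    have "relative_entropy P Q \<le> ereal r"
    proof (rule relative_entropy_le_if_dv_functional_le[OF assms])
      fix g :: "'a \<Rightarrow> real" and B assume "g \<in> borel_measurable Q" "\<And>x. \<bar>g x\<bar> \<le> B"
      from upper[OF this] show "dv_functional P Q g \<le> r" by (simp add: real)
    qed
    then show ?thesis by (simp add: real)
  next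
    \<comment> \<open>Impossible, since the zero function already contributes a real number to the
      supremum.\<close>
    case MInf
    with upper[of "\<lambda>_. 0" 0] show ?thesis by simp
  qed simp
  then show "relative_entropy P Q \<le> ?S" by (simp add: S_def)
qed

section \<open>Approximation by continuous functions\<close>

text \<open>Inner regularity gives \<open>K\<close> and outer regularity gives \<open>U\<close>,
  each at a cost of \<open>e / 2\<close>. Both are stated as suprema or infima of extended
  nonnegative reals, so the sets are extracted by contradiction.\<close>

lemma compact_open_approximation:
  fixes M :: "'a :: {second_countable_topology, complete_space} measure"
  assumes "finite_measure M" and sets: "sets M = sets borel" and A: "A \<in> sets borel" and e: "0 < e"
  obtains K U where "compact K" "open U" "K \<subseteq> A" "A \<subseteq> U" "measure M (U - K) < e"
proof -
  interpret finite_measure M by fact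
  note [measurable_cong] = sets
  have fin: "emeasure M (space M) \<noteq> \<infinity>" by simp
  have "\<exists>K. compact K \<and> K \<subseteq> A \<and> measure M A - e / 2 < measure M K"
  proof (rule ccontr)
    assume "\<not> ?thesis"
    then have *: "measure M K \<le> measure M A - e / 2" if "compact K" "K \<subseteq> A" for K
      using that by (auto simp: not_less)
    \<comment> \<open>\<open>ennreal\<close> sends negative numbers to 0, so the sign must be known
      before the comparison can be read in the reals.\<close>
    from *[of "{}"] have nonneg: "0 \<le> measure M A - e / 2" by simp
    have "emeasure M A \<le> ennreal (measure M A - e / 2)"
      unfolding inner_regular[OF sets fin A]
      by (rule SUP_least) (auto simp: emeasure_eq_measure intro!: ennreal_leI *)
    then show False using nonneg e by (simp add: emeasure_eq_measure)
  qed
  then obtain K where K: "compact K" "K \<subseteq> A" "measure M A - e / 2 < measure M K" by blast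
  have "\<exists>U. open U \<and> A \<subseteq> U \<and> measure M U < measure M A + e / 2"
  proof (rule ccontr)
    assume "\<not> ?thesis"
    then have *: "measure M A + e / 2 \<le> measure M U" if "open U" "A \<subseteq> U" for U
      using that by (auto simp: not_less)
    have "ennreal (measure M A + e / 2) \<le> emeasure M A"
      unfolding outer_regular[OF sets fin A]
      by (rule INF_greatest) (auto simp: emeasure_eq_measure intro!: ennreal_leI *)
    then show False using e by (simp add: emeasure_eq_measure)
  qed
  then obtain U where U: "open U" "A \<subseteq> U" "measure M U < measure M A + e / 2" by blast
  have "K \<in> sets M" "U \<in> sets M" using K(1) U(1) sets by (auto intro: borel_compact)
  then have "measure M (U - K) = measure M U - measure M K"
    using K U by (intro finite_measure_Diff) auto
  then have "measure M (U - K) < e" using K U by simp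
  with K U that show thesis by blast
qed

text \<open>One function must serve both measures. Uniting the compact sets and intersecting the
  open ones leaves a gap \<open>U - K\<close> that is small for \<open>P\<close> and for
  \<open>Q\<close>. A Urysohn function that is 1 on \<open>K\<close> and 0 off \<open>U\<close>
  differs from the indicator only in this gap.\<close>

lemma continuous_L1_approximation_indicator:
  fixes A :: "'a :: euclidean_space set"
  assumes "finite_measure P" and "finite_measure Q"
    and sets: "sets P = sets borel" "sets Q = sets borel"
    and A: "A \<in> sets borel" and e: "0 < e"
  obtains \<phi> :: "'a \<Rightarrow> real" where "continuous_on UNIV \<phi>" "\<And>x. \<bar>\<phi> x\<bar> \<le> 1"
    "(\<integral>x. \<bar>indicator A x - \<phi> x\<bar> \<partial>P) < e" "(\<integral>x. \<bar>indicator A x - \<phi> x\<bar> \<partial>Q) < e"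
proof -
  interpret P: finite_measure P by fact
  interpret Q: finite_measure Q by fact
  obtain K1 U1 where 1: "compact K1" "open U1" "K1 \<subseteq> A" "A \<subseteq> U1" "measure P (U1 - K1) < e"
    using compact_open_approximation[OF assms(1) sets(1) A e] .
  obtain K2 U2 where 2: "compact K2" "open U2" "K2 \<subseteq> A" "A \<subseteq> U2" "measure Q (U2 - K2) < e"
    using compact_open_approximation[OF assms(2) sets(2) A e] .
  define K U where "K = K1 \<union> K2" and "U = U1 \<inter> U2"
  have "closed K" "closed (- U)" "K \<inter> - U = {}"
    using 1 2 by (auto simp: K_def U_def compact_imp_closed)
  then obtain \<phi> :: "'a \<Rightarrow> real" where \<phi>: "continuous_on UNIV \<phi>"
    "\<And>x. \<phi> x \<in> closed_segment 1 0" "\<And>x. x \<in> K \<Longrightarrow> \<phi> x = 1" "\<And>x. x \<in> - U \<Longrightarrow> \<phi> x = 0"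
    by (rule Urysohn) blast
  have \<phi>_01: "0 \<le> \<phi> x" "\<phi> x \<le> 1" for x
    using \<phi>(2)[of x] by (auto simp: closed_segment_eq_real_ivl)
  have [measurable]: "\<phi> \<in> borel_measurable borel"
    using \<phi>(1) by (rule borel_measurable_continuous_onI)
  have bound: "(\<integral>x. \<bar>indicator A x - \<phi> x\<bar> \<partial>R) < e"
    if "finite_measure R" and sR: "sets R = sets borel" and V: "V \<in> sets borel" "U - K \<subseteq> V"
      and small: "measure R V < e" for R V
  proof -
    interpret R: finite_measure R by fact
    note [measurable_cong] = sR
    note [measurable] = V(1) A
    have pt: "\<bar>indicator A x - \<phi> x\<bar> \<le> indicator V x" for x
    proof (cases "x \<in> V")
      case True
      then show ?thesis using \<phi>_01[of x] by (auto simp: indicator_def)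
    next
      case False
      then have "x \<in> K \<or> x \<in> - U" using V by auto
      then show ?thesis using \<phi>(3,4)[of x] 1 2 by (auto simp: indicator_def K_def U_def)
    qed
    have "integrable R (\<lambda>x. \<bar>indicator A x - \<phi> x\<bar>)"
      by (intro R.integrable_const_bound[where B=1] always_eventually allI)
         (auto intro!: order_trans[OF pt] indicator_le_1)
    then have "(\<integral>x. \<bar>indicator A x - \<phi> x\<bar> \<partial>R) \<le> (\<integral>x. indicator V x \<partial>R)"
      using pt by (intro integral_mono) (auto simp: R.emeasure_eq_measure)
    also have "\<dots> < e" using small sR V by (simp add: sets_eq_imp_space_eq)
    finally show ?thesis .
  qed
  show thesis
  proof (rule that[of \<phi>])
    show "(\<integral>x. \<bar>indicator A x - \<phi> x\<bar> \<partial>P) < e"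
      by (rule bound[OF assms(1) sets(1) _ _ 1(5)])
         (use 1 in \<open>auto simp: K_def U_def intro: borel_compact\<close>)
    show "(\<integral>x. \<bar>indicator A x - \<phi> x\<bar> \<partial>Q) < e"
      by (rule bound[OF assms(2) sets(2) _ _ 2(5)])
         (use 2 in \<open>auto simp: K_def U_def intro: borel_compact\<close>)
  qed (use \<phi>(1) \<phi>_01 in \<open>auto simp: abs_of_nonneg\<close>)
qed

lemma integral_le_add:
  fixes a b c :: "'a \<Rightarrow> real"
  assumes "integrable R a" "integrable R b" "integrable R c" "\<And>x. a x \<le> b x + c x"
  shows "(\<integral>x. a x \<partial>R) \<le> (\<integral>x. b x \<partial>R) + (\<integral>x. c x \<partial>R)"
proof -
  have "(\<integral>x. a x \<partial>R) \<le> (\<integral>x. b x + c x \<partial>R)"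
    using assms by (intro integral_mono) auto
  then show ?thesis using assms by simp
qed

text \<open>Measure-theoretic induction: indicators are covered by the preceding approximation,
  errors scale and add, and a monotone limit is first replaced by a late member of the sequence,
  using dominated convergence.\<close>

lemma continuous_L1_approximation_nonneg:
  fixes u :: "'a :: euclidean_space \<Rightarrow> real"
  assumes "finite_measure P" and "finite_measure Q"
    and sets: "sets P = sets borel" "sets Q = sets borel"
    and u: "u \<in> borel_measurable borel" "\<And>x. 0 \<le> u x" "\<And>x. u x \<le> B" and e: "0 < e"
  shows "\<exists>\<phi> C. continuous_on UNIV \<phi> \<and> (\<forall>x. \<bar>\<phi> x\<bar> \<le> (C::real)) \<and>
    (\<integral>x. \<bar>u x - \<phi> x\<bar> \<partial>P) < e \<and> (\<integral>x. \<bar>u x - \<phi> x\<bar> \<partial>Q) < e"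
proof -
  interpret P: finite_measure P by fact
  interpret Q: finite_measure Q by fact
  note [measurable_cong] = sets
  have int: "integrable P (\<lambda>x. \<bar>v x - \<phi> x\<bar>) \<and> integrable Q (\<lambda>x. \<bar>v x - \<phi> x\<bar>)"
    if v: "v \<in> borel_measurable borel" "\<And>x. 0 \<le> v x" "\<And>x. v x \<le> B'" and
      \<phi>: "\<phi> \<in> borel_measurable borel" "\<And>x. \<bar>\<phi> x\<bar> \<le> C"
    for v \<phi> and B' C :: real
  proof -
    note [measurable] = v(1) \<phi>(1)
    have "\<bar>v x - \<phi> x\<bar> \<le> B' + C" for x using v(2,3)[of x] \<phi>(2)[of x] by linarith
    then show ?thesis
      by (auto intro!: P.integrable_const_bound[where B="B' + C"]
          Q.integrable_const_bound[where B="B' + C"])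
  qed
  define approx where "approx v e \<longleftrightarrow> (\<exists>\<phi> C. continuous_on UNIV \<phi> \<and> (\<forall>x. \<bar>\<phi> x\<bar> \<le> (C::real)) \<and>
    (\<integral>x. \<bar>v x - \<phi> x\<bar> \<partial>P) < e \<and> (\<integral>x. \<bar>v x - \<phi> x\<bar> \<partial>Q) < e)" for v e
  have approxE: thesis
    if "approx v e" "\<And>\<phi> C. continuous_on UNIV \<phi> \<Longrightarrow> (\<And>x. \<bar>\<phi> x\<bar> \<le> (C::real)) \<Longrightarrow>
      (\<integral>x. \<bar>v x - \<phi> x\<bar> \<partial>P) < e \<Longrightarrow> (\<integral>x. \<bar>v x - \<phi> x\<bar> \<partial>Q) < e \<Longrightarrow> thesis" for v e thesis
    using that unfolding approx_def by blast
  \<comment> \<open>The bound is a premise inside the induction predicate because each constituent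
    function needs its own. Since all functions are nonnegative, summands inherit the bound of the
    sum and members of an increasing sequence that of the limit.\<close>
  from u(1,2) have "(\<exists>B. \<forall>x. u x \<le> B) \<longrightarrow> (\<forall>e>0. approx u e)"
  proof (induction rule: borel_measurable_induct_real)
    case (set A)
    show ?case
    proof (intro impI allI)
      fix e :: real assume "0 < e"
      from continuous_L1_approximation_indicator[OF assms(1-4) set this]
      obtain \<phi> :: "'a \<Rightarrow> real" where "continuous_on UNIV \<phi>" "\<And>x. \<bar>\<phi> x\<bar> \<le> 1"
        "(\<integral>x. \<bar>indicator A x - \<phi> x\<bar> \<partial>P) < e" "(\<integral>x. \<bar>indicator A x - \<phi> x\<bar> \<partial>Q) < e" by blast
      then show "approx (indicat_real A) e"
        unfolding approx_def by metis
    qed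
  next
    case (mult v c)
    show ?case
    proof (intro impI allI, goal_cases)
      case (1 e)
      show ?case
      proof (cases "c = 0")
        case True
        with 1 show ?thesis
          unfolding approx_def by (intro exI[of _ "\<lambda>_. 0"] exI[of _ 0]) auto
      next
        case False
        with mult have c: "0 < c" by simp
        from 1 obtain B where "\<And>x. c * v x \<le> B" by auto
        with c have "\<And>x. v x \<le> B / c" by (simp add: pos_le_divide_eq mult.commute)
        moreover have "0 < e / c" using 1 c by simp
        ultimately have "approx v (e / c)" using mult.IH by blast
        then obtain \<phi> C where \<phi>: "continuous_on UNIV \<phi>" "\<And>x. \<bar>\<phi> x\<bar> \<le> C"
          "(\<integral>x. \<bar>v x - \<phi> x\<bar> \<partial>P) < e / c" "(\<integral>x. \<bar>v x - \<phi> x\<bar> \<partial>Q) < e / c"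
          by (rule approxE) blast
        have eq: "\<bar>c * v x - c * \<phi> x\<bar> = c * \<bar>v x - \<phi> x\<bar>" for x
          using c by (simp add: abs_mult flip: right_diff_distrib)
        show ?thesis
          unfolding approx_def
        proof (intro exI conjI allI)
          show "continuous_on UNIV (\<lambda>x. c * \<phi> x)" using \<phi>(1) by (intro continuous_intros)
          show "\<bar>c * \<phi> x\<bar> \<le> c * C" for x using \<phi>(2) c by (simp add: abs_mult)
        qed (use \<phi>(3,4) c in \<open>simp_all add: eq pos_less_divide_eq mult.commute\<close>)
      qed
    qed
  next
    case (add v w)
    show ?case
    proof (intro impI allI, goal_cases)
      case (1 e)
      then obtain B where B: "\<And>x. w x + v x \<le> B" by auto
      have vB: "v x \<le> B" and wB: "w x \<le> B" for x
        using B[of x] add.hyps(2)[of x] add.hyps(4)[of x] by auto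
      from 1 have e2: "0 < e / 2" by simp
      have "approx v (e / 2)" using add.IH(1) vB e2 by blast
      then obtain \<phi> C where \<phi>: "continuous_on UNIV \<phi>" "\<And>x. \<bar>\<phi> x\<bar> \<le> C"
        "(\<integral>x. \<bar>v x - \<phi> x\<bar> \<partial>P) < e / 2" "(\<integral>x. \<bar>v x - \<phi> x\<bar> \<partial>Q) < e / 2"
        by (rule approxE) blast
      have "approx w (e / 2)" using add.IH(2) wB e2 by blast
      then obtain \<psi> D where \<psi>: "continuous_on UNIV \<psi>" "\<And>x. \<bar>\<psi> x\<bar> \<le> D"
        "(\<integral>x. \<bar>w x - \<psi> x\<bar> \<partial>P) < e / 2" "(\<integral>x. \<bar>w x - \<psi> x\<bar> \<partial>Q) < e / 2"
        by (rule approxE) blast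
      have m: "\<phi> \<in> borel_measurable borel" "\<psi> \<in> borel_measurable borel"
        using \<phi>(1) \<psi>(1) by (auto intro: borel_measurable_continuous_onI)
      note int_v = int[OF add.hyps(1,2) vB m(1) \<phi>(2)]
      note int_w = int[OF add.hyps(3,4) wB m(2) \<psi>(2)]
      have sum_B: "\<bar>\<psi> x + \<phi> x\<bar> \<le> D + C" for x using \<phi>(2)[of x] \<psi>(2)[of x] by linarith
      have int_sum: "integrable P (\<lambda>x. \<bar>w x + v x - (\<psi> x + \<phi> x)\<bar>) \<and>
          integrable Q (\<lambda>x. \<bar>w x + v x - (\<psi> x + \<phi> x)\<bar>)"
        by (rule int[OF _ _ B _ sum_B]) (use add.hyps m in auto)
      have le: "(\<integral>x. \<bar>w x + v x - (\<psi> x + \<phi> x)\<bar> \<partial>R)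
          \<le> (\<integral>x. \<bar>w x - \<psi> x\<bar> \<partial>R) + (\<integral>x. \<bar>v x - \<phi> x\<bar> \<partial>R)"
        if "integrable R (\<lambda>x. \<bar>w x + v x - (\<psi> x + \<phi> x)\<bar>)" "integrable R (\<lambda>x. \<bar>w x - \<psi> x\<bar>)"
          "integrable R (\<lambda>x. \<bar>v x - \<phi> x\<bar>)" for R
        by (rule integral_le_add[OF that]) linarith
      show ?case
        unfolding approx_def
      proof (intro exI conjI allI)
        show "continuous_on UNIV (\<lambda>x. \<psi> x + \<phi> x)" using \<phi>(1) \<psi>(1) by (intro continuous_intros)
        show "\<bar>\<psi> x + \<phi> x\<bar> \<le> D + C" for x by (rule sum_B)
        show "(\<integral>x. \<bar>w x + v x - (\<psi> x + \<phi> x)\<bar> \<partial>P) < e"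
          using le[of P] int_v int_w int_sum \<phi>(3) \<psi>(3) by auto
        show "(\<integral>x. \<bar>w x + v x - (\<psi> x + \<phi> x)\<bar> \<partial>Q) < e"
          using le[of Q] int_v int_w int_sum \<phi>(4) \<psi>(4) by auto
      qed
    qed
  next
    case (seq U)
    show ?case
    proof (intro impI allI, goal_cases)
      case (1 e)
      then obtain B where B: "\<And>x. u x \<le> B" by auto
      have lim: "(\<lambda>i. U i x) \<longlonglongrightarrow> u x" for x using seq by simp
      have U_le: "U i x \<le> u x" for i x
        using seq.hyps(3) lim[of x] by (intro incseq_le) (auto simp: incseq_def le_fun_def)
      have UB: "U i x \<le> B" for i x using U_le B order_trans by blast
      note [measurable] = seq.hyps(1) u(1)
      have "(\<lambda>i. \<integral>x. \<bar>u x - U i x\<bar> \<partial>R) \<longlonglongrightarrow> (\<integral>x. 0 \<partial>R)"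
        if "finite_measure R" and sR: "sets R = sets borel" for R
      proof -
        interpret R: finite_measure R by fact
        note [measurable_cong] = sR
        show ?thesis
        proof (rule integral_dominated_convergence[where w="\<lambda>_. B"])
          show "AE x in R. (\<lambda>i. \<bar>u x - U i x\<bar>) \<longlonglongrightarrow> 0"
          proof (rule always_eventually, rule allI)
            show "(\<lambda>i. \<bar>u x - U i x\<bar>) \<longlonglongrightarrow> 0" for x
              using tendsto_rabs[OF tendsto_diff[OF tendsto_const[of "u x"] lim[of x]]] by simp
          qed
          show "AE x in R. norm \<bar>u x - U i x\<bar> \<le> B" for i
          proof (rule always_eventually, rule allI)
            show "norm \<bar>u x - U i x\<bar> \<le> B" for x
              using U_le[of i x] seq.hyps(2)[of i x] B[of x] by simp
          qed
        qed auto
      qed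
      from this[OF assms(1) sets(1)] this[OF assms(2) sets(2)] \<open>0 < e\<close>
      have "\<forall>\<^sub>F i in sequentially. (\<integral>x. \<bar>u x - U i x\<bar> \<partial>P) < e / 2 \<and> (\<integral>x. \<bar>u x - U i x\<bar> \<partial>Q) < e / 2"
        by (intro eventually_conj) (auto dest: order_tendstoD(2)[where a="e / 2"])
      then obtain i where i: "(\<integral>x. \<bar>u x - U i x\<bar> \<partial>P) < e / 2" "(\<integral>x. \<bar>u x - U i x\<bar> \<partial>Q) < e / 2"
        using eventually_happens by fastforce
      from \<open>0 < e\<close> have e2: "0 < e / 2" by simp
      have "approx (U i) (e / 2)" using seq.IH[of i] UB[of i] e2 by blast
      then obtain \<phi> C where \<phi>: "continuous_on UNIV \<phi>" "\<And>x. \<bar>\<phi> x\<bar> \<le> C"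
        "(\<integral>x. \<bar>U i x - \<phi> x\<bar> \<partial>P) < e / 2" "(\<integral>x. \<bar>U i x - \<phi> x\<bar> \<partial>Q) < e / 2"
        by (rule approxE) blast
      have m: "\<phi> \<in> borel_measurable borel"
        using \<phi>(1) by (auto intro: borel_measurable_continuous_onI)
      have UB': "\<bar>U i x\<bar> \<le> B" for x using UB[of i x] seq.hyps(2)[of i x] by simp
      note int_1 = int[OF u(1,2) B seq.hyps(1) UB']
      note int_2 = int[OF seq.hyps(1,2) UB m \<phi>(2), of i]
      note int_3 = int[OF u(1,2) B m \<phi>(2)]
      have le: "(\<integral>x. \<bar>u x - \<phi> x\<bar> \<partial>R) \<le> (\<integral>x. \<bar>u x - U i x\<bar> \<partial>R) + (\<integral>x. \<bar>U i x - \<phi> x\<bar> \<partial>R)"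
        if "integrable R (\<lambda>x. \<bar>u x - \<phi> x\<bar>)" "integrable R (\<lambda>x. \<bar>u x - U i x\<bar>)"
          "integrable R (\<lambda>x. \<bar>U i x - \<phi> x\<bar>)" for R
        by (rule integral_le_add[OF that]) linarith
      show ?case
        unfolding approx_def
      proof (intro exI conjI allI)
        show "continuous_on UNIV \<phi>" by (rule \<phi>)
        show "\<bar>\<phi> x\<bar> \<le> C" for x by (rule \<phi>)
        show "(\<integral>x. \<bar>u x - \<phi> x\<bar> \<partial>P) < e"
          using le[of P] int_1 int_2 int_3 \<phi>(3) i(1) by auto
        show "(\<integral>x. \<bar>u x - \<phi> x\<bar> \<partial>Q) < e"
          using le[of Q] int_1 int_2 int_3 \<phi>(4) i(2) by auto
      qed
    qed
  qed
  with u(3) e have "approx u e" by blast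
  then show ?thesis unfolding approx_def .
qed

text \<open>Shifting by \<open>B\<close> reduces to nonnegative functions. Clamping the
  approximation back to the interval from \<open>- B\<close> to \<open>B\<close> cannot increase its
  distance to \<open>g\<close>, whose values lie there; the resulting uniform bound controls the
  exponentials later.\<close>

lemma continuous_L1_approximation:
  fixes g :: "'a :: euclidean_space \<Rightarrow> real"
  assumes P: "finite_measure P" and Q: "finite_measure Q"
    and sets: "sets P = sets borel" "sets Q = sets borel"
    and g: "g \<in> borel_measurable borel" "\<And>x. \<bar>g x\<bar> \<le> B" and e: "0 < e"
  obtains \<phi> :: "'a \<Rightarrow> real" where "continuous_on UNIV \<phi>" "\<And>x. \<bar>\<phi> x\<bar> \<le> B"
    "(\<integral>x. \<bar>g x - \<phi> x\<bar> \<partial>P) < e" "(\<integral>x. \<bar>g x - \<phi> x\<bar> \<partial>Q) < e"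
proof -
  have B: "0 \<le> B" using g(2)[of undefined] by linarith
  have gB: "0 \<le> g x + B" "g x + B \<le> 2 * B" for x using g(2)[of x] by linarith+
  have "(\<lambda>x. g x + B) \<in> borel_measurable borel" using g(1) by simp
  from continuous_L1_approximation_nonneg[OF P Q sets this gB e]
  obtain \<psi> C where \<psi>: "continuous_on UNIV \<psi>" "\<And>x. \<bar>\<psi> x\<bar> \<le> C"
    "(\<integral>x. \<bar>g x + B - \<psi> x\<bar> \<partial>P) < e" "(\<integral>x. \<bar>g x + B - \<psi> x\<bar> \<partial>Q) < e"
    by blast
  define \<phi> where "\<phi> x = max (- B) (min B (\<psi> x - B))" for x
  have cont: "continuous_on UNIV \<phi>" unfolding \<phi>_def using \<psi>(1) by (intro continuous_intros)
  have \<phi>B: "\<bar>\<phi> x\<bar> \<le> B" for x using B by (auto simp: \<phi>_def)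
  have m: "\<phi> \<in> borel_measurable borel" "\<psi> \<in> borel_measurable borel"
    using cont \<psi>(1) by (auto intro: borel_measurable_continuous_onI)
  have pt: "\<bar>g x - \<phi> x\<bar> \<le> \<bar>g x + B - \<psi> x\<bar>" for x
    using g(2)[of x] unfolding \<phi>_def by linarith
  have "(\<integral>x. \<bar>g x - \<phi> x\<bar> \<partial>R) < e"
    if "finite_measure R" and sR: "sets R = sets borel" and le: "(\<integral>x. \<bar>g x + B - \<psi> x\<bar> \<partial>R) < e" for R
  proof -
    interpret R: finite_measure R by fact
    note [measurable_cong] = sR
    note [measurable] = m g(1)
    have b: "\<bar>g x + B - \<psi> x\<bar> \<le> 2 * B + C" for x using \<psi>(2)[of x] g(2)[of x] by linarith
    have "integrable R (\<lambda>x. \<bar>g x + B - \<psi> x\<bar>)"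
      by (rule R.integrable_const_bound[where B="2 * B + C"]) (use b in auto)
    moreover from this have "integrable R (\<lambda>x. \<bar>g x - \<phi> x\<bar>)"
      by (rule Bochner_Integration.integrable_bound) (use pt in auto)
    ultimately have "(\<integral>x. \<bar>g x - \<phi> x\<bar> \<partial>R) \<le> (\<integral>x. \<bar>g x + B - \<psi> x\<bar> \<partial>R)"
      using pt by (intro integral_mono)
    with le show ?thesis by simp
  qed
  from this[OF P sets(1) \<psi>(3)] this[OF Q sets(2) \<psi>(4)] show thesis
    by (rule that[OF cont \<phi>B])
qed

section \<open>Stability of the functional under bounded L1 convergence\<close>

lemma abs_exp_diff_le:
  fixes a b :: real
  assumes "\<bar>a\<bar> \<le> B" "\<bar>b\<bar> \<le> B"
  shows "\<bar>exp a - exp b\<bar> \<le> exp B * \<bar>a - b\<bar>"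
proof -
  have *: "exp s - exp t \<le> exp B * \<bar>s - t\<bar>" if "\<bar>s\<bar> \<le> B" for s t :: real
  proof -
    \<comment> \<open>Convexity: the tangent of \<open>exp\<close> at \<open>s\<close> lies below
      \<open>exp t\<close>.\<close>
    have "exp s * (1 + (t - s)) \<le> exp s * exp (t - s)"
      by (intro mult_left_mono exp_ge_add_one_self) simp
    also have "\<dots> = exp t" by (simp flip: exp_add)
    finally have "exp s - exp t \<le> exp s * (s - t)" by (simp add: algebra_simps)
    also have "\<dots> \<le> exp s * \<bar>s - t\<bar>" by (intro mult_left_mono) auto
    also have "\<dots> \<le> exp B * \<bar>s - t\<bar>" using that by (intro mult_right_mono) auto
    finally show ?thesis .
  qed
  from *[OF assms(1), of b] *[OF assms(2), of a] show ?thesis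
    by (simp add: abs_le_iff abs_minus_commute)
qed

text \<open>Without pointwise convergence, dominated convergence does not apply directly. Instead
  \<open>exp\<close> is Lipschitz on bounded intervals, so L1 convergence passes to the
  exponentials, and \<open>ln\<close> is continuous at their positive limit.\<close>

lemma tendsto_dv_functional_L1:
  assumes P: "prob_space P" and Q: "prob_space Q" and sets: "sets P = sets Q"
    and s: "\<And>k. s k \<in> borel_measurable Q" and g: "g \<in> borel_measurable Q"
    and B: "\<And>k x. \<bar>s k x\<bar> \<le> B" "\<And>x. \<bar>g x\<bar> \<le> B"
    and lim: "(\<lambda>k. \<integral>x. \<bar>g x - s k x\<bar> \<partial>P) \<longlonglongrightarrow> 0" "(\<lambda>k. \<integral>x. \<bar>g x - s k x\<bar> \<partial>Q) \<longlonglongrightarrow> 0"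
  shows "(\<lambda>k. dv_functional P Q (s k)) \<longlonglongrightarrow> dv_functional P Q g"
proof -
  interpret P: prob_space P by fact
  interpret Q: prob_space Q by fact
  note [measurable_cong] = sets
  note [measurable] = s g
  have int: "integrable P (s k)" "integrable P g" "integrable Q (s k)" "integrable Q g" for k
    using B by (auto intro!: P.integrable_const_bound[where B=B] Q.integrable_const_bound[where B=B])
  have int_exp: "integrable Q (\<lambda>x. exp (s k x))" "integrable Q (\<lambda>x. exp (g x))" for k
    using B by (auto intro!: Q.integrable_exp_bounded)
  have "(\<lambda>k. \<integral>x. s k x \<partial>P) \<longlonglongrightarrow> (\<integral>x. g x \<partial>P)"
  proof (rule LIM_zero_cancel, rule tendsto_0_le[OF lim(1), where K=1], rule always_eventually, rule allI)
    fix k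
    have "\<bar>(\<integral>x. s k x \<partial>P) - (\<integral>x. g x \<partial>P)\<bar> = \<bar>\<integral>x. g x - s k x \<partial>P\<bar>"
      using int by (simp add: abs_minus_commute)
    also have "\<dots> \<le> (\<integral>x. \<bar>g x - s k x\<bar> \<partial>P)" by (rule integral_abs_bound)
    finally show "norm ((\<integral>x. s k x \<partial>P) - (\<integral>x. g x \<partial>P)) \<le> norm (\<integral>x. \<bar>g x - s k x\<bar> \<partial>P) * 1" by simp
  qed
  moreover have "(\<lambda>k. \<integral>x. exp (s k x) \<partial>Q) \<longlonglongrightarrow> (\<integral>x. exp (g x) \<partial>Q)"
  proof (rule LIM_zero_cancel, rule tendsto_0_le[OF lim(2), where K="exp B"],
      rule always_eventually, rule allI)
    fix k
    have "\<bar>(\<integral>x. exp (s k x) \<partial>Q) - (\<integral>x. exp (g x) \<partial>Q)\<bar> = \<bar>\<integral>x. exp (g x) - exp (s k x) \<partial>Q\<bar>"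
      using int_exp by (simp add: abs_minus_commute)
    also have "\<dots> \<le> (\<integral>x. \<bar>exp (g x) - exp (s k x)\<bar> \<partial>Q)" by (rule integral_abs_bound)
    also have "\<dots> \<le> (\<integral>x. exp B * \<bar>g x - s k x\<bar> \<partial>Q)"
      using int int_exp by (intro integral_mono abs_exp_diff_le B) auto
    finally show "norm ((\<integral>x. exp (s k x) \<partial>Q) - (\<integral>x. exp (g x) \<partial>Q))
        \<le> norm (\<integral>x. \<bar>g x - s k x\<bar> \<partial>Q) * exp B"
      by (simp add: mult.commute)
  qed
  ultimately show ?thesis
    unfolding dv_functional_def using Q.integral_exp_pos[OF g B(2)]
    by (intro tendsto_intros) auto
qed

text \<open>Overwriting an approximation outside \<open>W\<close> by \<open>c\<close>, the value of
  \<open>g\<close> there, does not increase the L1 error. Thus the constant outside stays exact, and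
  continuity is required of \<open>\<phi>\<close> alone, not of the glued function.\<close>

lemma dv_functional_continuous_approximation:
  fixes g :: "'a :: euclidean_space \<Rightarrow> real"
  assumes P: "prob_space P" and Q: "prob_space Q"
    and sets: "sets P = sets borel" "sets Q = sets borel"
    and g: "g \<in> borel_measurable borel" "\<And>x. \<bar>g x\<bar> \<le> B" and W: "W \<in> sets borel"
    and c: "\<And>x. x \<notin> W \<Longrightarrow> g x = c" "\<bar>c\<bar> \<le> B" and a: "a < dv_functional P Q g"
  obtains \<phi> :: "'a \<Rightarrow> real" where "continuous_on UNIV \<phi>" "\<And>x. \<bar>\<phi> x\<bar> \<le> B"
    "a < dv_functional P Q (\<lambda>x. if x \<in> W then \<phi> x else c)"
proof -
  interpret P: prob_space P by fact
  interpret Q: prob_space Q by fact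
  have "\<forall>k. \<exists>\<phi>. continuous_on UNIV \<phi> \<and> (\<forall>x. \<bar>\<phi> x\<bar> \<le> B) \<and>
    (\<integral>x. \<bar>g x - \<phi> x\<bar> \<partial>P) < inverse (real (Suc k)) \<and> (\<integral>x. \<bar>g x - \<phi> x\<bar> \<partial>Q) < inverse (real (Suc k))"
  proof
    fix k :: nat
    have "0 < inverse (real (Suc k))" by simp
    from continuous_L1_approximation[OF P.finite_measure_axioms Q.finite_measure_axioms sets g this]
    obtain \<phi> where "continuous_on UNIV \<phi>" "\<And>x. \<bar>\<phi> x\<bar> \<le> B"
      "(\<integral>x. \<bar>g x - \<phi> x\<bar> \<partial>P) < inverse (real (Suc k))" "(\<integral>x. \<bar>g x - \<phi> x\<bar> \<partial>Q) < inverse (real (Suc k))"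
      by blast
    then show "\<exists>\<phi>. continuous_on UNIV \<phi> \<and> (\<forall>x. \<bar>\<phi> x\<bar> \<le> B) \<and>
      (\<integral>x. \<bar>g x - \<phi> x\<bar> \<partial>P) < inverse (real (Suc k)) \<and> (\<integral>x. \<bar>g x - \<phi> x\<bar> \<partial>Q) < inverse (real (Suc k))"
      by blast
  qed
  then obtain \<phi> where \<phi>: "\<And>k. continuous_on UNIV (\<phi> k)" "\<And>k x. \<bar>\<phi> k x\<bar> \<le> B"
    "\<And>k. (\<integral>x. \<bar>g x - \<phi> k x\<bar> \<partial>P) < inverse (real (Suc k))"
    "\<And>k. (\<integral>x. \<bar>g x - \<phi> k x\<bar> \<partial>Q) < inverse (real (Suc k))"
    by (elim choice[THEN exE]) blast
  define s where "s k x = (if x \<in> W then \<phi> k x else c)" for k x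
  have \<phi>_m[measurable]: "\<phi> k \<in> borel_measurable borel" for k
    using \<phi>(1) by (auto intro: borel_measurable_continuous_onI)
  have s_m: "s k \<in> borel_measurable borel" for k
    unfolding s_def[abs_def] using W by measurable
  have sB: "\<bar>s k x\<bar> \<le> B" for k x using \<phi>(2) c(2) by (simp add: s_def)
  have "(\<lambda>k. \<integral>x. \<bar>g x - s k x\<bar> \<partial>R) \<longlonglongrightarrow> 0"
    if "prob_space R" and sR: "sets R = sets borel"
      and le: "\<And>k. (\<integral>x. \<bar>g x - \<phi> k x\<bar> \<partial>R) < inverse (real (Suc k))" for R
  proof (rule tendsto_sandwich[OF _ _ tendsto_const LIMSEQ_inverse_real_of_nat])
    interpret R: prob_space R by fact
    note [measurable_cong] = sR
    note [measurable] = g(1) s_m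
    have b: "\<bar>g x - s k x\<bar> \<le> 2 * B" "\<bar>g x - \<phi> k x\<bar> \<le> 2 * B" for k x
      using g(2)[of x] sB[of k x] \<phi>(2)[of k x] by linarith+
    have "(\<integral>x. \<bar>g x - s k x\<bar> \<partial>R) \<le> (\<integral>x. \<bar>g x - \<phi> k x\<bar> \<partial>R)" for k
    proof (intro integral_mono R.integrable_const_bound[where B="2 * B"])
      show "\<bar>g x - s k x\<bar> \<le> \<bar>g x - \<phi> k x\<bar>" for x using c by (simp add: s_def)
    qed (use b in auto)
    moreover note le
    ultimately show "\<forall>\<^sub>F k in sequentially. (\<integral>x. \<bar>g x - s k x\<bar> \<partial>R) \<le> inverse (real (Suc k))"
      by (meson always_eventually order_trans less_imp_le)
  qed (auto intro!: always_eventually)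
  from this[OF P sets(1) \<phi>(3)] this[OF Q sets(2) \<phi>(4)]
  have "(\<lambda>k. dv_functional P Q (s k)) \<longlonglongrightarrow> dv_functional P Q g"
    by (intro tendsto_dv_functional_L1[OF P Q _ _ _ sB g(2)])
       (use s_m g(1) sets in \<open>simp_all cong: measurable_cong_sets\<close>)
  from order_tendstoD(1)[OF this a] obtain k where "a < dv_functional P Q (s k)"
    using eventually_happens by fastforce
  then show thesis
    using that[OF \<phi>(1,2)] unfolding s_def[abs_def] by blast
qed

section \<open>Entropy seen through a window, and quantization\<close>

text \<open>A rational chosen inside each jump separates the jumps: for \<open>x < y\<close> the one
  at \<open>x\<close> lies below \<open>f y\<close>, the one at \<open>y\<close> above it. The
  choice is therefore injective.\<close>

lemma countable_right_jumps:
  fixes f :: "'a :: linorder \<Rightarrow> ereal"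
  assumes "mono f"
  shows "countable {x. f x < (INF y\<in>{x<..}. f y)}" (is "countable ?J")
proof -
  have "\<forall>x\<in>?J. \<exists>q::rat. f x < ereal (of_rat q) \<and> ereal (of_rat q) < (INF y\<in>{x<..}. f y)"
  proof
    fix x assume "x \<in> ?J"
    then show "\<exists>q::rat. f x < ereal (of_rat q) \<and> ereal (of_rat q) < (INF y\<in>{x<..}. f y)"
      using ereal_dense3 by blast
  qed
  then obtain q :: "'a \<Rightarrow> rat" where q: "\<And>x. x \<in> ?J \<Longrightarrow> f x < ereal (of_rat (q x))"
    "\<And>x. x \<in> ?J \<Longrightarrow> ereal (of_rat (q x)) < (INF y\<in>{x<..}. f y)"
    by metis
  have less: "q x < q y" if "x \<in> ?J" "y \<in> ?J" "x < y" for x y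
  proof -
    have "ereal (of_rat (q x)) < f y"
      by (rule less_le_trans[OF q(2)[OF that(1)] INF_lower]) (use that in simp)
    also have "\<dots> < ereal (of_rat (q y))" by (rule q(1)[OF that(2)])
    finally show ?thesis by (simp add: of_rat_less)
  qed
  have "inj_on q ?J"
  proof (rule inj_onI)
    fix x y assume "x \<in> ?J" "y \<in> ?J" "q x = q y"
    with less[of x y] less[of y x] show "x = y" by (cases x y rule: linorder_cases) auto
  qed
  then show ?thesis by (rule countable_image_inj_on[rotated]) simp
qed

section \<open>Relative entropy seen through an open window\<close>

definition window_observables :: "real \<Rightarrow> (real ^ 'n \<Rightarrow> real) set" where
  "window_observables \<kappa> = {g \<in> borel_measurable borel. (\<exists>B. \<forall>x. \<bar>g x\<bar> \<le> B) \<and>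
     (\<exists>c. \<forall>x. (\<exists>i. \<kappa> \<le> \<bar>x $ i\<bar>) \<longrightarrow> g x = c)}"

lemma window_observablesI:
  assumes "g \<in> borel_measurable borel" "\<And>x. \<bar>g x\<bar> \<le> B"
    and "\<And>x i. \<kappa> \<le> \<bar>x $ i\<bar> \<Longrightarrow> g x = c"
  shows "g \<in> window_observables \<kappa>"
  using assms unfolding window_observables_def by blast

text \<open>This is \<open>E\<close> of the outline. For probability measures on the Borel sets it
  is the relative entropy after the complement of the open window has been collapsed to one
  point.\<close>

definition window_entropy :: "(real ^ 'n) measure \<Rightarrow> (real ^ 'n) measure \<Rightarrow> real \<Rightarrow> ereal" where
  "window_entropy P Q \<kappa> = (SUP g\<in>window_observables \<kappa>. ereal (dv_functional P Q g))"

lemma mono_window_entropy: "mono (window_entropy P Q)"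
proof (rule monoI)
  fix \<kappa> \<kappa>' :: real assume "\<kappa> \<le> \<kappa>'"
  then have "window_observables \<kappa> \<subseteq> (window_observables \<kappa>' :: (real ^ 'n \<Rightarrow> real) set)"
    unfolding window_observables_def by (auto, meson order_trans)
  then show "window_entropy P Q \<kappa> \<le> window_entropy P Q \<kappa>'"
    unfolding window_entropy_def by (rule SUP_subset_mono) simp
qed

lemma window_entropy_le:
  fixes P Q :: "(real ^ 'n) measure"
  assumes P: "prob_space P" and Q: "prob_space Q"
    and sets: "sets P = sets borel" "sets Q = sets borel"
  shows "window_entropy P Q \<kappa> \<le> relative_entropy P Q"
  unfolding window_entropy_def
proof (rule SUP_least)
  fix g :: "real ^ 'n \<Rightarrow> real" assume "g \<in> window_observables \<kappa>"
  then obtain B where "g \<in> borel_measurable borel" "\<And>x. \<bar>g x\<bar> \<le> B"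
    by (auto simp: window_observables_def)
  then show "ereal (dv_functional P Q g) \<le> relative_entropy P Q"
    using sets by (intro dv_functional_le_relative_entropy[OF P Q]) (auto cong: measurable_cong_sets)
qed

lemma outside_window_measurable: "{x :: real ^ 'n. \<exists>i. \<kappa> \<le> \<bar>x $ i\<bar>} \<in> sets borel"
proof -
  have "closed (\<Union>i. {x :: real ^ 'n. \<kappa> \<le> \<bar>x $ i\<bar>})"
    by (intro closed_UN finite ballI closed_Collect_le continuous_intros)
  moreover have "{x :: real ^ 'n. \<exists>i. \<kappa> \<le> \<bar>x $ i\<bar>} = (\<Union>i. {x. \<kappa> \<le> \<bar>x $ i\<bar>})" by auto
  ultimately show ?thesis by simp
qed

text \<open>A nearly optimal observable is cut off to 0 outside the window of size \<open>k\<close>.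
  Every point eventually lies inside, so the functional converges by dominated convergence;
  monotonicity extends the bound from one \<open>k\<close> to all larger window sizes.\<close>

lemma window_entropy_tendsto:
  fixes P Q :: "(real ^ 'n) measure"
  assumes P: "prob_space P" and Q: "prob_space Q"
    and sets: "sets P = sets borel" "sets Q = sets borel"
  shows "(window_entropy P Q \<longlongrightarrow> relative_entropy P Q) at_top"
proof (rule order_tendstoI)
  fix a assume "relative_entropy P Q < a"
  then show "\<forall>\<^sub>F \<kappa> in at_top. window_entropy P Q \<kappa> < a"
    by (intro always_eventually allI le_less_trans[OF window_entropy_le[OF assms]])
next
  fix a assume a: "a < relative_entropy P Q"
  have sPQ: "sets P = sets Q" using sets by simp
  from a obtain g B where g: "g \<in> borel_measurable Q" "\<And>x. \<bar>g x\<bar> \<le> B"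
    and ag: "a < ereal (dv_functional P Q g)"
    unfolding donsker_varadhan[OF P Q sPQ] less_SUP_iff by auto
  have g_m[measurable]: "g \<in> borel_measurable borel"
    using g(1) sets by (simp cong: measurable_cong_sets)
  define s where "s k x = (if \<exists>i. real k \<le> \<bar>x $ i\<bar> then 0 else g x)" for k x
  have s_m: "s k \<in> borel_measurable borel" for k
    using outside_window_measurable unfolding s_def[abs_def] by measurable
  have sB: "\<bar>s k x\<bar> \<le> B" for k x using g(2)[of x] by (auto simp: s_def)
  have "(\<lambda>k. dv_functional P Q (s k)) \<longlonglongrightarrow> dv_functional P Q g"
  proof (rule tendsto_dv_functional[OF P Q sPQ _ g(1) sB])
    show "s k \<in> borel_measurable Q" for k
      using s_m sets by (simp cong: measurable_cong_sets)
    fix x :: "real ^ 'n"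
    have "\<forall>\<^sub>F k in sequentially. s k x = g x"
      using eventually_gt_at_top[of "nat \<lceil>norm x\<rceil>"]
    proof eventually_elim
      case (elim k)
      then have "norm x < real k" by linarith
      then have "\<not> real k \<le> \<bar>x $ i\<bar>" for i
        using component_le_norm_cart[of x i] by linarith
      then show ?case by (simp add: s_def)
    qed
    then show "(\<lambda>k. s k x) \<longlonglongrightarrow> g x" by (rule tendsto_eventually)
  qed
  then have "(\<lambda>k. ereal (dv_functional P Q (s k))) \<longlonglongrightarrow> ereal (dv_functional P Q g)" by simp
  from order_tendstoD(1)[OF this ag] obtain k where k: "a < ereal (dv_functional P Q (s k))"
    using eventually_happens by fastforce
  have "s k \<in> window_observables (real k)"
    by (rule window_observablesI[OF s_m sB, where c=0]) (auto simp: s_def)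
  then have "ereal (dv_functional P Q (s k)) \<le> window_entropy P Q (real k)"
    unfolding window_entropy_def by (rule SUP_upper)
  with k have ak: "a < window_entropy P Q (real k)" by simp
  show "\<forall>\<^sub>F \<kappa> in at_top. a < window_entropy P Q \<kappa>"
    using eventually_ge_at_top[of "real k"]
    by eventually_elim (use ak mono_window_entropy[of P Q] in \<open>auto simp: mono_def intro: less_le_trans\<close>)
qed

section \<open>Window, mesh and measurability of the quantization\<close>

lemma window_bounds:
  assumes "0 < \<delta>"
  shows "\<kappa> \<le> window \<kappa> \<delta>" "window \<kappa> \<delta> < \<kappa> + \<delta>"
proof -
  define c where "c = real_of_int \<lceil>\<kappa> / \<delta>\<rceil>"
  have "\<kappa> / \<delta> \<le> c" "c < \<kappa> / \<delta> + 1" unfolding c_def by linarith+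
  then have "\<kappa> \<le> \<delta> * c" "\<delta> * c < \<kappa> + \<delta>"
    using assms by (simp_all add: field_simps)
  then show "\<kappa> \<le> window \<kappa> \<delta>" "window \<kappa> \<delta> < \<kappa> + \<delta>"
    using assms by (auto simp: window_def c_def)
qed

lemma floor_mesh_bounds:
  fixes x \<delta> :: real
  assumes "0 < \<delta>" "0 \<le> x"
  shows "0 \<le> of_int \<lfloor>x / \<delta>\<rfloor> * \<delta>" "of_int \<lfloor>x / \<delta>\<rfloor> * \<delta> \<le> x" "x < of_int \<lfloor>x / \<delta>\<rfloor> * \<delta> + \<delta>"
proof -
  define c where "c = real_of_int \<lfloor>x / \<delta>\<rfloor>"
  have "c \<le> x / \<delta>" "x / \<delta> < c + 1" unfolding c_def by linarith+
  then have "c * \<delta> \<le> x" "x < c * \<delta> + \<delta>"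
    using assms by (simp_all add: field_simps)
  then show "of_int \<lfloor>x / \<delta>\<rfloor> * \<delta> \<le> x" "x < of_int \<lfloor>x / \<delta>\<rfloor> * \<delta> + \<delta>"
    unfolding c_def .
qed (use assms in simp)

text \<open>The first bound expresses that rounding goes towards 0: it never pushes a point closer
  to the boundary of the window.\<close>

lemma mesh_round_bounds:
  assumes "0 < \<delta>"
  shows "\<bar>mesh_round \<delta> x\<bar> \<le> \<bar>x\<bar>" "\<bar>mesh_round \<delta> x - x\<bar> < \<delta>"
  using floor_mesh_bounds[OF assms, of x] floor_mesh_bounds[OF assms, of "- x"]
  by (auto simp: mesh_round_def)

text \<open>Together with the hypothesis on the default value, this ensures that a point kept by the
  quantization is never mistaken for one sent to the default value.\<close>

lemma mesh_round_in_scaled_lattice: "(\<chi> i. mesh_round \<delta> (x $ i)) \<in> scaled_lattice \<delta>"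
  unfolding scaled_lattice_def mesh_round_def
  by (auto simp: mult.commute) (metis mult_minus_right of_int_minus)

lemma mesh_round_measurable [measurable]: "mesh_round \<delta> \<in> borel_measurable borel"
  unfolding mesh_round_def[abs_def] by measurable

lemma borel_measurable_vec_lambda:
  fixes f :: "'a \<Rightarrow> 'n::finite \<Rightarrow> real"
  assumes "\<And>i. (\<lambda>x. f x i) \<in> borel_measurable M"
  shows "(\<lambda>x. \<chi> i. f x i) \<in> borel_measurable M"
  by (subst borel_measurable_euclidean_space) (auto simp: Basis_vec_def inner_axis assms)

lemma quantize_measurable [measurable]: "quantize w \<kappa> \<delta> \<in> borel_measurable borel"
proof -
  have "(\<lambda>x :: real ^ 'n. x $ i) \<in> borel_measurable borel" for i
    by (intro borel_measurable_continuous_onI continuous_intros)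
  then have "(\<lambda>x :: real ^ 'n. \<chi> i. mesh_round \<delta> (x $ i)) \<in> borel_measurable borel"
    by (intro borel_measurable_vec_lambda) measurable
  with outside_window_measurable show ?thesis
    unfolding quantize_def[abs_def] by measurable
qed

section \<open>Upper and lower bounds for the quantized entropy\<close>

lemma quantized_entropy_le:
  fixes P Q :: "(real ^ 'n) measure"
  assumes P: "prob_space P" and Q: "prob_space Q"
    and sets: "sets P = sets borel" "sets Q = sets borel" and \<delta>: "0 < \<delta>"
  shows "relative_entropy (distr P borel (quantize w \<kappa> \<delta>)) (distr Q borel (quantize w \<kappa> \<delta>))
    \<le> window_entropy P Q (\<kappa> + \<delta>)" (is "relative_entropy (distr P borel ?T) _ \<le> _")
proof -
  interpret P: prob_space P by fact
  interpret Q: prob_space Q by fact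
  have sPQ: "sets P = sets Q" using sets by simp
  have TP: "?T \<in> measurable P borel" and TQ: "?T \<in> measurable Q borel"
    using quantize_measurable sets by (simp_all cong: measurable_cong_sets)
  show ?thesis
    unfolding donsker_varadhan[OF P.prob_space_distr[OF TP] Q.prob_space_distr[OF TQ], simplified]
  proof (rule SUP_least, clarsimp)
    fix h :: "real ^ 'n \<Rightarrow> real" and B
    assume h: "h \<in> borel_measurable borel" and B: "\<forall>x. \<bar>h x\<bar> \<le> B"
    \<comment> \<open>The window may be rounded up by less than one mesh, so the pulled back
      observable is guaranteed to be constant only from \<open>\<kappa> + \<delta>\<close>
      on.\<close>
    have "h (?T x) = h w" if "\<kappa> + \<delta> \<le> \<bar>x $ i\<bar>" for x i
    proof -
      have "window \<kappa> \<delta> \<le> \<bar>x $ i\<bar>" using that window_bounds[OF \<delta>, of \<kappa>] by simp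
      then have "?T x = w" by (auto simp: quantize_def)
      then show ?thesis by simp
    qed
    then have "h \<circ> ?T \<in> window_observables (\<kappa> + \<delta>)"
      using h B measurable_comp[OF quantize_measurable h]
      by (auto simp: window_observables_def)
    then show "ereal (dv_functional (distr P borel ?T) (distr Q borel ?T) h) \<le> window_entropy P Q (\<kappa> + \<delta>)"
      unfolding dv_functional_distr[OF TQ sPQ h] window_entropy_def by (rule SUP_upper)
  qed
qed

text \<open>A point of the open window is kept for every mesh size, so only the rounding moves it,
  by less than the mesh in each coordinate.\<close>

lemma tendsto_quantized_point:
  fixes x :: "real ^ 'n"
  assumes "\<And>i. \<bar>x $ i\<bar> < \<kappa>" and S: "\<And>n. 0 < S n" "S \<longlonglongrightarrow> (0::real)"
  shows "(\<lambda>n. quantize (w n) \<kappa> (S n) x) \<longlonglongrightarrow> x"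
proof (rule vec_tendstoI)
  fix i
  have eq: "quantize (w n) \<kappa> (S n) x $ i = mesh_round (S n) (x $ i)" for n
  proof -
    have "\<not> window \<kappa> (S n) \<le> \<bar>x $ j\<bar>" for j
      using assms(1)[of j] window_bounds(1)[OF S(1)[of n], of \<kappa>] by linarith
    then show ?thesis by (simp add: quantize_def)
  qed
  have "(\<lambda>n. mesh_round (S n) (x $ i)) \<longlonglongrightarrow> x $ i"
    by (rule LIM_zero_cancel, rule tendsto_0_le[OF S(2), where K=1])
       (use mesh_round_bounds(2)[OF S(1)] S(1) in \<open>auto intro!: always_eventually less_imp_le simp: abs_of_pos\<close>)
  then show "(\<lambda>n. quantize (w n) \<kappa> (S n) x $ i) \<longlonglongrightarrow> x $ i" by (simp add: eq)
qed

text \<open>A nearly optimal window observable is replaced by one that is continuous inside the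
  window and constant outside. Observables \<open>h \<delta>\<close> of the quantized point are
  built whose pullbacks converge to it at every point, so their functionals eventually exceed
  \<open>a\<close>, and the quantized entropy dominates these functionals.\<close>

lemma eventually_less_quantized_entropy:
  fixes P Q :: "(real ^ 'n) measure"
  assumes P: "prob_space P" and Q: "prob_space Q"
    and sets: "sets P = sets borel" "sets Q = sets borel"
    and w: "\<And>\<delta>. 0 < \<delta> \<Longrightarrow> w \<delta> \<notin> scaled_lattice \<delta>"
    and a: "a < window_entropy P Q \<kappa>"
  shows "\<forall>\<^sub>F \<delta> in at_right 0. a < relative_entropy (distr P borel (quantize (w \<delta>) \<kappa> \<delta>))
    (distr Q borel (quantize (w \<delta>) \<kappa> \<delta>))"
proof -
  interpret P: prob_space P by fact
  interpret Q: prob_space Q by fact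
  have sPQ: "sets P = sets Q" using sets by simp
  let ?T = "\<lambda>\<delta>. quantize (w \<delta>) \<kappa> \<delta>"
  have TP: "?T \<delta> \<in> measurable P borel" and TQ: "?T \<delta> \<in> measurable Q borel" for \<delta>
    using quantize_measurable sets by (simp_all cong: measurable_cong_sets)
  from a obtain g where g: "g \<in> window_observables \<kappa>" and ag: "a < ereal (dv_functional P Q g)"
    unfolding window_entropy_def less_SUP_iff by blast
  from g obtain B0 c where g_m: "g \<in> borel_measurable borel" and B0: "\<And>x. \<bar>g x\<bar> \<le> B0"
    and c: "\<And>x i. \<kappa> \<le> \<bar>x $ i\<bar> \<Longrightarrow> g x = c"
    unfolding window_observables_def by blast
  define B where "B = max B0 \<bar>c\<bar>"
  have gB: "\<bar>g x\<bar> \<le> B" for x using B0[of x] by (simp add: B_def)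
  define W where "W = - {x :: real ^ 'n. \<exists>i. \<kappa> \<le> \<bar>x $ i\<bar>}"
  have W: "W \<in> sets borel" using outside_window_measurable unfolding W_def by (rule borel_comp)
  have gW: "g x = c" if "x \<notin> W" for x using that c by (auto simp: W_def)
  \<comment> \<open>The approximation lemma takes a real threshold, whereas \<open>a\<close> may be
    minus infinity; \<open>r\<close> is a real number strictly in between.\<close>
  from dense[OF ag] obtain a' where a': "a < a'" "a' < ereal (dv_functional P Q g)" by blast
  then obtain r where r: "a < ereal r" "r < dv_functional P Q g" by (cases a') auto
  obtain \<phi> where \<phi>: "continuous_on UNIV \<phi>" "\<And>x. \<bar>\<phi> x\<bar> \<le> B"
    "r < dv_functional P Q (\<lambda>x. if x \<in> W then \<phi> x else c)"
    using dv_functional_continuous_approximation[OF P Q sets g_m gB W gW _ r(2)]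
    unfolding B_def by (metis max.cobounded2)
  \<comment> \<open>Cutting off at \<open>\<kappa> - \<delta>\<close> makes \<open>h \<delta>\<close> blind to cells that meet the boundary of the window, which
    are sent to \<open>w \<delta>\<close> or kept depending on whether \<open>\<kappa> / \<delta>\<close> is an integer.\<close>
  define h where "h \<delta> y = (if y = w \<delta> \<or> (\<exists>i. \<kappa> - \<delta> < \<bar>y $ i\<bar>) then c else \<phi> y)" for \<delta> y
  have \<phi>_m: "\<phi> \<in> borel_measurable borel" using \<phi>(1) by (rule borel_measurable_continuous_onI)
  have h_m: "h \<delta> \<in> borel_measurable borel" for \<delta>
  proof -
    have "open {y :: real ^ 'n. \<exists>i. \<kappa> - \<delta> < \<bar>y $ i\<bar>}"
      by (intro open_Collect_ex open_Collect_less continuous_intros)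
    then have "{w \<delta>} \<union> {y. \<exists>i. \<kappa> - \<delta> < \<bar>y $ i\<bar>} \<in> sets borel"
      by (intro sets.Un) auto
    moreover have "h \<delta> = (\<lambda>y. if y \<in> {w \<delta>} \<union> {y. \<exists>i. \<kappa> - \<delta> < \<bar>y $ i\<bar>} then c else \<phi> y)"
      by (auto simp: h_def fun_eq_iff)
    ultimately show ?thesis using \<phi>_m by simp
  qed
  have hB: "\<bar>h \<delta> y\<bar> \<le> B" for \<delta> y using \<phi>(2) by (auto simp: h_def B_def)
  let ?f = "\<lambda>x. if x \<in> W then \<phi> x else c"
  \<comment> \<open>Dominated convergence is stated for sequences, hence the passage to sequences
    decreasing to 0; the right endpoint 1 is arbitrary.\<close>
  have "((\<lambda>\<delta>. dv_functional P Q (h \<delta> \<circ> ?T \<delta>)) \<longlongrightarrow> dv_functional P Q ?f) (at_right 0)"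
  proof (rule tendsto_at_right_sequentially[of 0 1])
    fix S :: "nat \<Rightarrow> real"
    assume S: "\<And>n. 0 < S n" "S \<longlonglongrightarrow> 0"
    show "(\<lambda>n. dv_functional P Q (h (S n) \<circ> ?T (S n))) \<longlonglongrightarrow> dv_functional P Q ?f"
    proof (rule tendsto_dv_functional[OF P Q sPQ])
      show "h (S n) \<circ> ?T (S n) \<in> borel_measurable Q" for n
        by (rule measurable_comp[OF TQ h_m])
      show "?f \<in> borel_measurable Q"
        using W \<phi>_m sets by (simp cong: measurable_cong_sets)
      show "\<bar>(h (S n) \<circ> ?T (S n)) x\<bar> \<le> B" for n x using hB by simp
      fix x :: "real ^ 'n"
      show "(\<lambda>n. (h (S n) \<circ> ?T (S n)) x) \<longlonglongrightarrow> ?f x"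
      proof (cases "x \<in> W")
        case True
        then have x: "\<bar>x $ i\<bar> < \<kappa>" for i by (auto simp: W_def not_le)
        have lim: "(\<lambda>n. ?T (S n) x) \<longlonglongrightarrow> x" by (rule tendsto_quantized_point[OF x S])
        have "isCont \<phi> x" using \<phi>(1) by (simp add: continuous_on_eq_continuous_at)
        then have "(\<lambda>n. \<phi> (?T (S n) x)) \<longlonglongrightarrow> \<phi> x" using lim by (rule isCont_tendsto_compose)
        moreover have "\<forall>\<^sub>F n in sequentially. (h (S n) \<circ> ?T (S n)) x = \<phi> (?T (S n) x)"
        proof -
          \<comment> \<open>Once the mesh is smaller than the distance of every coordinate to the
            boundary, the cutoff in \<open>h\<close> no longer affects the image of
            \<open>x\<close>, because rounding does not increase absolute values.\<close>
          have "\<forall>\<^sub>F n in sequentially. \<forall>i. S n < \<kappa> - \<bar>x $ i\<bar>"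
            by (rule eventually_all_finite) (rule order_tendstoD(2)[OF S(2)], use x in simp)
          then show ?thesis
          proof eventually_elim
            case (elim n)
            have "\<not> window \<kappa> (S n) \<le> \<bar>x $ j\<bar>" for j
              using x[of j] window_bounds(1)[OF S(1)[of n], of \<kappa>] by linarith
            then have T: "?T (S n) x = (\<chi> i. mesh_round (S n) (x $ i))" by (simp add: quantize_def)
            then have "?T (S n) x \<noteq> w (S n)"
              using w[OF S(1)[of n]] mesh_round_in_scaled_lattice by metis
            moreover have "\<not> \<kappa> - S n < \<bar>?T (S n) x $ i\<bar>" for i
              using elim[rule_format, of i] mesh_round_bounds(1)[OF S(1)[of n], of "x $ i"]
              by (simp add: T)
            ultimately show ?case by (simp add: h_def)
          qed
        qed
        ultimately show ?thesis
          using True by (simp add: tendsto_cong)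
      next
        case False
        then obtain i where i: "\<kappa> \<le> \<bar>x $ i\<bar>" by (auto simp: W_def)
        \<comment> \<open>Such a point either goes to the default value or is kept. In the latter
          case rounding costs less than one mesh, so coordinate \<open>i\<close> stays beyond the
          cutoff. Both outcomes give exactly \<open>c\<close>.\<close>
        have "h (S n) (?T (S n) x) = c" for n
        proof (cases "\<exists>j. window \<kappa> (S n) \<le> \<bar>x $ j\<bar>")
          case True
          then show ?thesis by (simp add: quantize_def h_def)
        next
          case nw: False
          then have "?T (S n) x $ i = mesh_round (S n) (x $ i)" by (simp add: quantize_def)
          then have "\<kappa> - S n < \<bar>?T (S n) x $ i\<bar>"
            using i mesh_round_bounds(2)[OF S(1)[of n], of "x $ i"] by linarith
          then show ?thesis by (auto simp: h_def)
        qed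
        then show ?thesis using False by simp
      qed
    qed
  qed simp
  then have "((\<lambda>\<delta>. ereal (dv_functional P Q (h \<delta> \<circ> ?T \<delta>))) \<longlongrightarrow> ereal (dv_functional P Q ?f)) (at_right 0)"
    by simp
  moreover have "a < ereal (dv_functional P Q ?f)" using r \<phi>(3) by (simp add: less_trans)
  ultimately have "\<forall>\<^sub>F \<delta> in at_right 0. a < ereal (dv_functional P Q (h \<delta> \<circ> ?T \<delta>))"
    by (rule order_tendstoD(1))
  then show ?thesis
  proof eventually_elim
    case (elim \<delta>)
    note elim
    also have "ereal (dv_functional P Q (h \<delta> \<circ> ?T \<delta>))
        = ereal (dv_functional (distr P borel (?T \<delta>)) (distr Q borel (?T \<delta>)) (h \<delta>))"
      by (simp add: dv_functional_distr[OF TQ sPQ h_m])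
    also have "\<dots> \<le> relative_entropy (distr P borel (?T \<delta>)) (distr Q borel (?T \<delta>))"
      by (rule dv_functional_le_relative_entropy[OF P.prob_space_distr[OF TP] Q.prob_space_distr[OF TQ] _ _ hB])
         (use h_m in simp_all)
    finally show ?case .
  qed
qed

section \<open>The iterated limit\<close>

theorem lemma8p1:
  fixes M :: "'a measure" and N :: "'b measure"
    and X :: "'a \<Rightarrow> real ^ 'n" and Y :: "'b \<Rightarrow> real ^ 'n"
    and \<omega> :: "real \<Rightarrow> real \<Rightarrow> real ^ 'n"
  assumes "prob_space M" and "prob_space N"
    and "X \<in> borel_measurable M" and "Y \<in> borel_measurable N"
    and "\<And>\<kappa> \<delta>. \<kappa> > 0 \<Longrightarrow> \<delta> > 0 \<Longrightarrow> \<omega> \<kappa> \<delta> \<notin> scaled_lattice \<delta>"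
  shows "let D = (\<lambda>\<kappa> \<delta>. D_KL M (\<lambda>a. quantize (\<omega> \<kappa> \<delta>) \<kappa> \<delta> (X a))
                             N (\<lambda>b. quantize (\<omega> \<kappa> \<delta>) \<kappa> \<delta> (Y b)))
         in countable {\<kappa>. \<kappa> > 0 \<and> \<not> (\<exists>l. (D \<kappa> \<longlongrightarrow> l) (at_right 0))} \<and>
            ((\<lambda>\<kappa>. Liminf (at_right 0) (D \<kappa>)) \<longlongrightarrow> D_KL M X N Y) at_top \<and>
            ((\<lambda>\<kappa>. Limsup (at_right 0) (D \<kappa>)) \<longlongrightarrow> D_KL M X N Y) at_top"
proof -
  define P where "P = distr M borel X"
  define Q where "Q = distr N borel Y"
  define D where "D \<kappa> \<delta> = D_KL M (\<lambda>a. quantize (\<omega> \<kappa> \<delta>) \<kappa> \<delta> (X a))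
    N (\<lambda>b. quantize (\<omega> \<kappa> \<delta>) \<kappa> \<delta> (Y b))" for \<kappa> \<delta>
  let ?E = "window_entropy P Q"
  have P: "prob_space P" and Q: "prob_space Q"
    unfolding P_def Q_def using assms by (auto intro: prob_space.prob_space_distr)
  have sets: "sets P = sets borel" "sets Q = sets borel" by (simp_all add: P_def Q_def)
  have D_eq: "D \<kappa> \<delta> = relative_entropy (distr P borel (quantize (\<omega> \<kappa> \<delta>) \<kappa> \<delta>))
      (distr Q borel (quantize (\<omega> \<kappa> \<delta>) \<kappa> \<delta>))" for \<kappa> \<delta>
    using assms(3,4) by (simp add: D_def D_KL_def P_def Q_def distr_distr comp_def)
  have upper: "D \<kappa> \<delta> \<le> ?E \<kappa>'" if "0 < \<delta>" "\<kappa> + \<delta> \<le> \<kappa>'" for \<kappa> \<kappa>' \<delta>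
    using quantized_entropy_le[OF P Q sets that(1)] monoD[OF mono_window_entropy that(2)]
    unfolding D_eq by (rule order_trans)
  have lower: "\<forall>\<^sub>F \<delta> in at_right 0. a < D \<kappa> \<delta>" if "0 < \<kappa>" "a < ?E \<kappa>" for a \<kappa>
    unfolding D_eq using assms(5)[OF that(1)] that(2)
    by (rule eventually_less_quantized_entropy[OF P Q sets])
  have eventually_upper: "\<forall>\<^sub>F \<delta> in at_right 0. D \<kappa> \<delta> \<le> ?E \<kappa>'" if "\<kappa> < \<kappa>'" for \<kappa> \<kappa>'
    using that unfolding eventually_at_right_field
    by (intro exI[of _ "\<kappa>' - \<kappa>"]) (auto intro!: upper)
  have E_le_Liminf: "?E \<kappa> \<le> Liminf (at_right 0) (D \<kappa>)" if "0 < \<kappa>" for \<kappa>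
    unfolding le_Liminf_iff using lower[OF that] by blast
  \<comment> \<open>Any fixed positive shift would serve: it has to absorb the mesh size near 0 and
    must not affect the limit at infinity.\<close>
  have Limsup_le_E: "Limsup (at_right 0) (D \<kappa>) \<le> ?E (\<kappa> + 1)" for \<kappa>
    by (rule Limsup_bounded) (rule eventually_upper, simp)
  have Liminf_le_Limsup: "Liminf (at_right 0) (D \<kappa>) \<le> Limsup (at_right 0) (D \<kappa>)" for \<kappa>
    by (rule Liminf_le_Limsup) (rule trivial_limit_at_right_real)
  have lim: "(?E \<longlongrightarrow> D_KL M X N Y) at_top"
    using window_entropy_tendsto[OF P Q sets] by (simp add: D_KL_def P_def Q_def)
  have lim_shift: "((\<lambda>\<kappa>. ?E (\<kappa> + 1)) \<longlongrightarrow> D_KL M X N Y) at_top"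
    by (rule filterlim_compose[OF lim])
       (rule filterlim_tendsto_add_at_top[OF tendsto_const filterlim_ident, of 1, simplified add.commute])
  \<comment> \<open>Contrapositive: without a jump of \<open>E\<close> to the right of
    \<open>\<kappa>\<close>, the upper bounds by \<open>E\<close> at larger window sizes close up on
    the lower bound at \<open>\<kappa>\<close>, so the inner limit exists and equals
    \<open>E\<close> at \<open>\<kappa>\<close>.\<close>
  have "{\<kappa>. \<kappa> > 0 \<and> \<not> (\<exists>l. (D \<kappa> \<longlongrightarrow> l) (at_right 0))} \<subseteq> {\<kappa>. ?E \<kappa> < (INF \<kappa>'\<in>{\<kappa><..}. ?E \<kappa>')}"
  proof (rule subsetI, rule CollectI, rule ccontr)
    fix \<kappa> assume "\<kappa> \<in> {\<kappa>. \<kappa> > 0 \<and> \<not> (\<exists>l. (D \<kappa> \<longlongrightarrow> l) (at_right 0))}"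
    then have \<kappa>: "0 < \<kappa>" and no_lim: "\<not> (D \<kappa> \<longlongrightarrow> ?E \<kappa>) (at_right 0)" by auto
    assume "\<not> ?E \<kappa> < (INF \<kappa>'\<in>{\<kappa><..}. ?E \<kappa>')"
    then have le: "(INF \<kappa>'\<in>{\<kappa><..}. ?E \<kappa>') \<le> ?E \<kappa>" by simp
    have "(D \<kappa> \<longlongrightarrow> ?E \<kappa>) (at_right 0)"
    proof (rule order_tendstoI)
      fix b assume "?E \<kappa> < b"
      with le have "(INF \<kappa>'\<in>{\<kappa><..}. ?E \<kappa>') < b" by (rule le_less_trans)
      then obtain \<kappa>' where "\<kappa> < \<kappa>'" "?E \<kappa>' < b" by (auto simp: INF_less_iff)
      then show "\<forall>\<^sub>F \<delta> in at_right 0. D \<kappa> \<delta> < b"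
        using eventually_upper[of \<kappa> \<kappa>'] by (auto elim!: eventually_mono intro: le_less_trans)
    qed (rule lower[OF \<kappa>])
    with no_lim show False ..
  qed
  then have count: "countable {\<kappa>. \<kappa> > 0 \<and> \<not> (\<exists>l. (D \<kappa> \<longlongrightarrow> l) (at_right 0))}"
    by (rule countable_subset) (rule countable_right_jumps[OF mono_window_entropy])
  \<comment> \<open>The default value is known to avoid the lattice only for positive
    \<open>\<kappa>\<close>, so the lower bound is an eventual statement.\<close>
  have ev_lower: "\<forall>\<^sub>F \<kappa> in at_top. ?E \<kappa> \<le> Liminf (at_right 0) (D \<kappa>)"
    using eventually_gt_at_top[of 0] by eventually_elim (rule E_le_Liminf)
  have ev_lower': "\<forall>\<^sub>F \<kappa> in at_top. ?E \<kappa> \<le> Limsup (at_right 0) (D \<kappa>)"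
    using ev_lower by eventually_elim (rule order_trans[OF _ Liminf_le_Limsup])
  note count
  moreover have "((\<lambda>\<kappa>. Liminf (at_right 0) (D \<kappa>)) \<longlongrightarrow> D_KL M X N Y) at_top"
    by (intro tendsto_sandwich[OF ev_lower _ lim lim_shift] always_eventually allI
        order_trans[OF Liminf_le_Limsup Limsup_le_E])
  moreover have "((\<lambda>\<kappa>. Limsup (at_right 0) (D \<kappa>)) \<longlongrightarrow> D_KL M X N Y) at_top"
    by (intro tendsto_sandwich[OF ev_lower' _ lim lim_shift] always_eventually allI Limsup_le_E)
  ultimately show ?thesis
    unfolding Let_def D_def[abs_def] by blast
qed

end
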